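(* Let $(X,d)$ be a compact metric space and let $\{\xi_n\}_{n\ge1}$ be an exponentially mixing stationary process on a probability space $(\Omega,\mathscr{A},\mathbb{P})$ taking values in $X$, with distribution $\mu$ (that is, $\mu(A)=\mathbb{P}(\xi_1\in A)$ for all Borel sets $A\subset X$). Assume that $\mu$ is Ahlfors $s$-regular with $0<s<\infty$. Let $\{\ell_n\}_{n\ge1}$ be a sequence of positive numbers decreasing to zero whose upper Besicovitch-Taylor index $\alpha$ satisfies $\alpha<s$, and let $E=\limsup_{n\to\infty}B(\xi_n,\ell_n)=\{y\in X: y\in B(\xi_n,\ell_n)\text{ for infinitely many }n\}$. Suppose that, for a constant $b\in(0,\frac13)$, there exists an increasing sequence of positive integers $\{k_i\}$ with $k_i\to\infty$, $\lim_{i\to\infty}\frac{k_{i+1}}{k_i}=1$ and $\lim_{i\to\infty}\frac{\log_{b^{-1}} n_{k_i}}{k_i}=\alpha$, where $n_k=\#\{n\ge1:\ell_n\in[b^{k-1},b^{k-2})\}$. Then for every analytic set $G\subset X$ with $\dim_{\rm P}(G)>s-\alpha$ we have $\mathbb{P}(E\cap G\neq\varnothing)=1$, and moreover $\dim_{\rm P}(E\cap G)=\dim_{\rm P}(G)$ almost surely.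
   Context: $B(x,r)$ denotes the closed ball with center $x$ and radius $r$. A stationary process $\{\xi_n\}_{n\ge1}$ is exponentially mixing if there are constants $C>0$ and $0<\rho<1$ such that $|\mathbb{P}(\xi_1\in A\mid D)-\mathbb{P}(\xi_1\in A)|\le C\rho^n$ for all $n\ge1$, all balls $A\subset X$ and all $D\in\mathscr{A}^{n+1}$ (with $\mathbb{P}(D)>0$), where $\mathscr{A}^{n+1}$ is the sub-$\sigma$-field generated by $\{\xi_{n+i}\}_{i\ge1}$. $\mu$ is Ahlfors $s$-regular if there is a constant $1\le c_1<\infty$ with $c_1^{-1}r^s\le\mu(B(x,r))\le c_1r^s$ for all $x\in X$ and $0<r\le\operatorname{diam}X$. The upper Besicovitch-Taylor index of $\{\ell_n\}$ is $\alpha=\inf\{t\le s:\sum_{n=1}^\infty\ell_n^t<\infty\}=\sup\{t\le s:\sum_{n=1}^\infty\ell_n^t=\infty\}$. $\dim_{\rm P}$ denotes packing dimension in $(X,d)$; by convention it equals $-\infty$ for the empty set. *)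

theory Defs
  imports "HOL-Probability.Probability"
begin

text \<open>
  The compact metric space \<open>X\<close> is rendered as a type of class \<^class>\<open>metric_space\<close> whose
  universe is compact. Sequences written with indices \<open>n \<ge> 1\<close> are functions on \<^typ>\<open>nat\<close> whose
  value at \<open>0\<close> is never used.
\<close>

section \<open>Stationary and exponentially mixing processes\<close>

definition stationary_process :: "'w measure \<Rightarrow> (nat \<Rightarrow> 'w \<Rightarrow> 'x::metric_space) \<Rightarrow> bool" where
  "stationary_process M \<xi> \<longleftrightarrow>
     (\<forall>n\<ge>1. \<xi> n \<in> borel_measurable M) \<and>
     (\<forall>k. distr M (PiM {1..} (\<lambda>_. borel)) (\<lambda>\<omega>. \<lambda>n\<in>{1..}. \<xi> (n + k) \<omega>) =
          distr M (PiM {1..} (\<lambda>_. borel)) (\<lambda>\<omega>. \<lambda>n\<in>{1..}. \<xi> n \<omega>))"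

text \<open>The \<open>\<sigma>\<close>-field generated by \<open>\<xi> m, \<xi> (m + 1), \<dots>\<close>.\<close>

definition future_events :: "'w measure \<Rightarrow> (nat \<Rightarrow> 'w \<Rightarrow> 'x::metric_space) \<Rightarrow> nat \<Rightarrow> 'w set set" where
  "future_events M \<xi> m =
     sigma_sets (space M) (\<Union>j\<in>{m..}. {\<xi> j -` B \<inter> space M | B. B \<in> sets borel})"

definition exponentially_mixing :: "'w measure \<Rightarrow> (nat \<Rightarrow> 'w \<Rightarrow> 'x::metric_space) \<Rightarrow> bool" where
  "exponentially_mixing M \<xi> \<longleftrightarrow>
     (\<exists>C>0. \<exists>\<rho>. 0 < \<rho> \<and> \<rho> < 1 \<and>
        (\<forall>n\<ge>1. \<forall>x r. \<forall>D\<in>future_events M \<xi> (n + 1). 0 < r \<longrightarrow> 0 < measure M D \<longrightarrow>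
           \<bar>\<P>(\<omega> in M. \<xi> 1 \<omega> \<in> cball x r \<bar> \<omega> \<in> D) - \<P>(\<omega> in M. \<xi> 1 \<omega> \<in> cball x r)\<bar>
             \<le> C * \<rho> ^ n))"

section \<open>Regular measures and random covering sets\<close>

definition ahlfors_regular :: "real \<Rightarrow> 'x::metric_space measure \<Rightarrow> bool" where
  "ahlfors_regular s \<mu> \<longleftrightarrow>
     (\<exists>c\<ge>1. \<forall>x r. 0 < r \<longrightarrow> r \<le> diameter (UNIV :: 'x set) \<longrightarrow>
        inverse c * r powr s \<le> measure \<mu> (cball x r) \<and> measure \<mu> (cball x r) \<le> c * r powr s)"

definition covering_set :: "(nat \<Rightarrow> 'w \<Rightarrow> 'x::metric_space) \<Rightarrow> (nat \<Rightarrow> real) \<Rightarrow> 'w \<Rightarrow> 'x set" where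
  "covering_set \<xi> l \<omega> = {y. infinite {n. 1 \<le> n \<and> y \<in> cball (\<xi> n \<omega>) (l n)}}"

text \<open>
  The supremum form of the index is used because, for \<open>s \<ge> 0\<close>, its set always contains \<open>0\<close> and is
  bounded by \<open>s\<close>, whereas the set in the infimum form is empty when the series diverges at \<open>s\<close>, and
  \<^const>\<open>Inf\<close> of the empty set is unspecified on the reals. The two forms agree otherwise, see
  \<open>upper_bt_index_eq_Inf\<close> below.
\<close>

definition upper_bt_index :: "real \<Rightarrow> (nat \<Rightarrow> real) \<Rightarrow> real" where
  "upper_bt_index s l = Sup {t. t \<le> s \<and> \<not> summable (\<lambda>n. l (Suc n) powr t)}"

lemma upper_bt_index_eq_Inf:
  fixes l :: "nat \<Rightarrow> real"
  assumes s: "0 < s" and pos: "\<And>n. 1 \<le> n \<Longrightarrow> 0 < l n" and lim: "l \<longlonglongrightarrow> 0"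
    and sm: "summable (\<lambda>n. l (Suc n) powr s)"
  shows "upper_bt_index s l = Inf {t. t \<le> s \<and> summable (\<lambda>n. l (Suc n) powr t)}"
proof -
  define A where "A = {t. t \<le> s \<and> \<not> summable (\<lambda>n. l (Suc n) powr t)}"
  define B where "B = {t. t \<le> s \<and> summable (\<lambda>n. l (Suc n) powr t)}"
  have "(\<lambda>n. l (Suc n)) \<longlonglongrightarrow> 0" using lim by (rule LIMSEQ_Suc)
  then have small: "eventually (\<lambda>n. l (Suc n) < 1) sequentially"
    by (rule order_tendstoD) simp
  have up: "summable (\<lambda>n. l (Suc n) powr u)"
    if t: "summable (\<lambda>n. l (Suc n) powr t)" and "t \<le> u" for t u
  proof (rule summable_comparison_test_ev[OF _ t])
    show "eventually (\<lambda>n. norm (l (Suc n) powr u) \<le> l (Suc n) powr t) sequentially"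
      using small
    proof eventually_elim
      case (elim n)
      then show ?case using pos[of "Suc n"] \<open>t \<le> u\<close> by (auto intro: powr_mono')
    qed
  qed
  have "l (Suc n) powr 0 = 1" for n using pos[of "Suc n"] by simp
  then have "\<not> summable (\<lambda>n. l (Suc n) powr 0)" by (simp add: summable_const_iff)
  then have A0: "0 \<in> A" using s by (simp add: A_def)
  have Bs: "s \<in> B" using sm by (simp add: B_def)
  have AB: "t < u" if "t \<in> A" "u \<in> B" for t u
    using that up[of u t] by (force simp: A_def B_def)
  have bA: "bdd_above A" by (rule bdd_aboveI[of _ s]) (simp add: A_def)
  have bB: "bdd_below B" by (rule bdd_belowI[of _ 0]) (use AB[OF A0] in force)
  have "Sup A \<le> Inf B"
    using A0 Bs AB by (intro cSup_least cInf_greatest) (auto intro: less_imp_le)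
  moreover have "Inf B \<le> Sup A"
  proof (rule ccontr)
    assume "\<not> Inf B \<le> Sup A"
    then obtain c where c: "Sup A < c" "c < Inf B" by (meson dense not_le)
    have "c \<notin> A" using cSup_upper[OF _ bA, of c] c by auto
    moreover have "c \<notin> B" using cInf_lower[OF _ bB, of c] c by auto
    moreover have "c \<le> s" using cInf_lower[OF Bs bB] c by simp
    ultimately show False by (auto simp: A_def B_def)
  qed
  ultimately show ?thesis unfolding upper_bt_index_def A_def B_def by (rule antisym)
qed

text \<open>The exponent \<open>k - 2\<close> is negative for \<open>k = 1\<close>, hence integer powers.\<close>

definition scale_count :: "real \<Rightarrow> (nat \<Rightarrow> real) \<Rightarrow> nat \<Rightarrow> nat" where
  "scale_count b l k = card {n. 1 \<le> n \<and> l n \<in> {b powi (int k - 1) ..< b powi (int k - 2)}}"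

text \<open>Logarithm of a natural number with \<open>log 0 = -\<infinity>\<close>; the library's \<open>log a 0\<close> is \<open>0\<close>.\<close>

definition ext_log :: "real \<Rightarrow> nat \<Rightarrow> ereal" where
  "ext_log a m = (if m = 0 then - \<infinity> else ereal (log a (real m)))"

section \<open>Packing dimension\<close>

text \<open>
  A packing is represented by the set of its pairs (centre, radius), since a ball of a metric space
  does not determine them, and the gauge is \<open>(2 r) powr t\<close>. Finite packings suffice, because
  the sum over an infinite packing is the supremum over its finite subpackings.
\<close>

definition packings :: "real \<Rightarrow> 'x::metric_space set \<Rightarrow> ('x \<times> real) set set" where
  "packings \<delta> A =
     {P. finite P \<and> (\<forall>(x, r)\<in>P. x \<in> A \<and> 0 < r \<and> r \<le> \<delta>) \<and>
         disjoint_family_on (\<lambda>(x, r). cball x r) P}"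

definition packing_premeasure :: "real \<Rightarrow> 'x::metric_space set \<Rightarrow> ennreal" where
  "packing_premeasure t A =
     (INF \<delta>\<in>{0<..}. SUP P\<in>packings \<delta> A. \<Sum>(x, r)\<in>P. ennreal ((2 * r) powr t))"

definition packing_measure :: "real \<Rightarrow> 'x::metric_space set \<Rightarrow> ennreal" where
  "packing_measure t A =
     (INF F\<in>{F :: nat \<Rightarrow> 'x set. A \<subseteq> (\<Union>i. F i)}. \<Sum>i. packing_premeasure t (F i))"

definition packing_dim :: "'x::metric_space set \<Rightarrow> ereal" where
  "packing_dim A =
     (if A = {} then - \<infinity> else Inf (ereal ` {t. 0 \<le> t \<and> packing_measure t A = 0}))"

text \<open>
  Analytic sets as continuous images of the Baire space: the type \<^typ>\<open>nat \<Rightarrow> nat\<close> carries the product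
  topology of the discrete topology on \<^typ>\<open>nat\<close>.
\<close>

definition analytic_set :: "'x::metric_space set \<Rightarrow> bool" where
  "analytic_set A \<longleftrightarrow>
     A = {} \<or> (\<exists>f :: (nat \<Rightarrow> nat) \<Rightarrow> 'x. continuous_on UNIV f \<and> range f = A)"

end

theory Submission
  imports Defs
begin

text \<open>
  The proof combines a second moment estimate, which shows that the random balls hit every large
  set, with a Baire category argument, which turns hitting into a lower bound for the dimension of
  the limsup set.

  Hitting. Let the packing premeasure of \<open>A\<close> with exponent \<open>\<gamma> > s - \<alpha>\<close> be infinite. Then, for
  infinitely many \<open>q\<close>, the set \<open>A\<close> contains about \<open>b powr (- q \<gamma>)\<close> points with mutual distances above
  \<open>b ^ q\<close> (\<open>infinite_premeasure_imp_separated_sets\<close>). As the ratios of consecutive \<open>k i\<close> tend to \<open>1\<close>, the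
  scale may be assumed to be some \<open>K = k i\<close>, where about \<open>b powr (- K \<alpha>)\<close> random balls of comparable
  radius are available. The expected number of their centres close to the chosen points is about
  \<open>b powr (- K (\<gamma> + \<alpha> - s))\<close> and tends to infinity. By exponential mixing, centres decorrelate after a
  lag of order \<open>K\<close>, so the variance exceeds the mean at most by a factor of order \<open>K\<close>, and Chebyshev's
  inequality shows that \<open>A\<close> is almost surely hit by balls of arbitrarily large index
  (\<open>miss_prob_le\<close>, \<open>covering_hits_large_set\<close>).

  Category. Let \<open>G\<close> be the image of the Baire space under a continuous map \<open>f\<close>, with dimension above
  \<open>g > s - \<alpha>\<close>. Call a set \<open>\<sigma>\<close>-finite if it is a countable union of sets with finite premeasure of
  exponent \<open>g\<close>. Deleting from the Baire space all basic open sets with \<open>\<sigma>\<close>-finite image leaves a nonempty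
  closed set \<open>F\<close> such that no relatively open part of \<open>F\<close>, unless empty, has a \<open>\<sigma>\<close>-finite image
  (\<open>analytic_kernel\<close>). All the countably many basic parts of \<open>F\<close> have images with infinite premeasure, so
  almost surely the random balls hit every one of them infinitely often. The preimage of the
  limsup set is then a dense \<open>G\<^sub>\<delta>\<close> subset of \<open>F\<close>. Finite premeasure passes to closures, so by Baire's
  theorem such a subset cannot have a \<open>\<sigma>\<close>-finite image (\<open>limsup_not_sigma_finite\<close>). Hence almost surely the
  dimension of the limsup set within \<open>G\<close> is at least \<open>g\<close>; in particular it is not \<open>-\<infinity>\<close>, so the
  intersection is nonempty. Letting \<open>g\<close> increase to the dimension of \<open>G\<close> through the rationals gives
  the theorem.
\<close>

section \<open>Packing premeasures and \<sigma>-finiteness\<close>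

lemma packings_mono: "\<delta> \<le> \<delta>' \<Longrightarrow> packings \<delta> A \<subseteq> packings \<delta>' A"
  unfolding packings_def by fastforce

lemma packing_premeasure_empty [simp]: "packing_premeasure t {} = 0"
proof -
  have *: "packings \<delta> ({} :: 'a set) = {{}}" for \<delta>
    by (auto simp: packings_def disjoint_family_on_def)
  have "{0<..} \<noteq> ({} :: real set)" by auto
  then show ?thesis unfolding packing_premeasure_def * by simp
qed

lemma packing_measure_mono: "A \<subseteq> B \<Longrightarrow> packing_measure t A \<le> packing_measure t B"
  unfolding packing_measure_def by (rule INF_superset_mono) auto

lemma packing_dim_mono:
  assumes "A \<subseteq> B"
  shows "packing_dim A \<le> packing_dim B"
proof (cases "A = {}")
  case True
  then show ?thesis by (simp add: packing_dim_def)
next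
  case False
  have "ereal ` {t. 0 \<le> t \<and> packing_measure t B = 0} \<subseteq> ereal ` {t. 0 \<le> t \<and> packing_measure t A = 0}"
    using packing_measure_mono[OF assms] by (intro image_mono) (auto simp flip: le_zero_eq intro: order_trans)
  then show ?thesis using False assms by (auto simp: packing_dim_def intro: Inf_superset_mono)
qed

lemma packing_premeasure_finiteE:
  assumes "packing_premeasure t A < \<top>"
  obtains \<delta> B where "0 < \<delta>" "0 \<le> B"
    "\<And>P. P \<in> packings \<delta> A \<Longrightarrow> (\<Sum>(x, r)\<in>P. (2 * r) powr t) \<le> B"
proof -
  from assms obtain \<delta> where \<delta>: "0 < \<delta>"
    and fin: "(SUP P\<in>packings \<delta> A. \<Sum>(x, r)\<in>P. ennreal ((2 * r) powr t)) < \<top>"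
    unfolding packing_premeasure_def by (auto simp: INF_less_iff)
  define B where "B = (SUP P\<in>packings \<delta> A. \<Sum>(x, r)\<in>P. ennreal ((2 * r) powr t))"
  have "(\<Sum>(x, r)\<in>P. (2 * r) powr t) \<le> enn2real B" if "P \<in> packings \<delta> A" for P
  proof -
    have "ennreal (\<Sum>(x, r)\<in>P. (2 * r) powr t) = (\<Sum>(x, r)\<in>P. ennreal ((2 * r) powr t))"
      by (subst sum_ennreal[symmetric]) (auto intro!: sum.cong)
    also have "\<dots> \<le> B" unfolding B_def using that by (rule SUP_upper)
    also have "\<dots> = ennreal (enn2real B)" using fin by (simp add: B_def)
    finally show ?thesis by (simp add: ennreal_le_iff)
  qed
  then show ?thesis using that[OF \<delta>, of "enn2real B"] by auto
qed

lemma packing_premeasure_le: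
  assumes "0 < \<delta>" "\<And>P. P \<in> packings \<delta> A \<Longrightarrow> (\<Sum>(x, r)\<in>P. (2 * r) powr t) \<le> B"
  shows "packing_premeasure t A \<le> ennreal B"
proof -
  have "packing_premeasure t A \<le> (SUP P\<in>packings \<delta> A. \<Sum>(x, r)\<in>P. ennreal ((2 * r) powr t))"
    unfolding packing_premeasure_def using assms(1) by (intro INF_lower) simp
  also have "\<dots> \<le> ennreal B"
  proof (rule SUP_least)
    fix P assume "P \<in> packings \<delta> A"
    have "(\<Sum>(x, r)\<in>P. ennreal ((2 * r) powr t)) = ennreal (\<Sum>(x, r)\<in>P. (2 * r) powr t)"
      by (subst sum_ennreal[symmetric]) (auto intro!: sum.cong)
    also have "\<dots> \<le> ennreal B" using assms(2)[OF \<open>P \<in> _\<close>] by (rule ennreal_leI)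
    finally show "(\<Sum>(x, r)\<in>P. ennreal ((2 * r) powr t)) \<le> ennreal B" .
  qed
  finally show ?thesis .
qed

lemma packing_premeasure_finite_mono:
  assumes fin: "packing_premeasure t B < \<top>" and "A \<subseteq> B" "t \<le> g"
  shows "packing_premeasure g A < \<top>"
proof -
  obtain \<delta> C where \<delta>: "0 < \<delta>" "0 \<le> C"
    and C: "\<And>P. P \<in> packings \<delta> B \<Longrightarrow> (\<Sum>(x, r)\<in>P. (2 * r) powr t) \<le> C"
    using packing_premeasure_finiteE[OF fin] by blast
  have "packing_premeasure g A \<le> ennreal C"
  proof (rule packing_premeasure_le)
    show "0 < min \<delta> (1/2)" using \<delta> by simp
    fix P assume P: "P \<in> packings (min \<delta> (1/2)) A"
    have "(\<Sum>(x, r)\<in>P. (2 * r) powr g) \<le> (\<Sum>(x, r)\<in>P. (2 * r) powr t)"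
      using P \<open>t \<le> g\<close> by (intro sum_mono) (auto simp: packings_def intro!: powr_mono')
    also have "\<dots> \<le> C" using P \<open>A \<subseteq> B\<close> by (intro C) (fastforce simp: packings_def)
    finally show "(\<Sum>(x, r)\<in>P. (2 * r) powr g) \<le> C" .
  qed
  then show ?thesis using ennreal_less_top le_less_trans by blast
qed

text \<open>
  In a packing by balls of radius at most \<open>d\<close>, raising the exponent from \<open>g\<close> to \<open>t\<close> costs each
  term a factor of at most \<open>(2 d) powr (t - g)\<close>, which tends to \<open>0\<close> with \<open>d\<close>.
\<close>

lemma packing_premeasure_eq_0:
  assumes fin: "packing_premeasure g A < \<top>" and "g < t"
  shows "packing_premeasure t A = 0"
proof -
  obtain \<delta> C where \<delta>: "0 < \<delta>" "0 \<le> C"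
    and C: "\<And>P. P \<in> packings \<delta> A \<Longrightarrow> (\<Sum>(x, r)\<in>P. (2 * r) powr g) \<le> C"
    using packing_premeasure_finiteE[OF fin] by blast
  have bound: "packing_premeasure t A \<le> ennreal ((2 * d) powr (t - g) * C)" if d: "0 < d" "d \<le> \<delta>" for d
  proof (rule packing_premeasure_le[OF d(1)])
    fix P assume P: "P \<in> packings d A"
    have "(\<Sum>(x, r)\<in>P. (2 * r) powr t) \<le> (\<Sum>(x, r)\<in>P. (2 * d) powr (t - g) * (2 * r) powr g)"
    proof (intro sum_mono, clarify)
      fix x r assume "(x, r) \<in> P"
      then have r: "0 < r" "r \<le> d" using P by (auto simp: packings_def)
      have "(2 * r) powr t = (2 * r) powr (t - g) * (2 * r) powr g"
        using r by (simp flip: powr_add)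
      also have "\<dots> \<le> (2 * d) powr (t - g) * (2 * r) powr g"
        using r \<open>g < t\<close> by (intro mult_right_mono powr_mono2) auto
      finally show "(2 * r) powr t \<le> (2 * d) powr (t - g) * (2 * r) powr g" .
    qed
    also have "\<dots> = (2 * d) powr (t - g) * (\<Sum>(x, r)\<in>P. (2 * r) powr g)"
      by (simp add: sum_distrib_left case_prod_unfold)
    also have "\<dots> \<le> (2 * d) powr (t - g) * C"
      using P packings_mono[OF d(2)] by (intro mult_left_mono C) auto
    finally show "(\<Sum>(x, r)\<in>P. (2 * r) powr t) \<le> (2 * d) powr (t - g) * C" .
  qed
  have "eventually (\<lambda>d::real. 0 \<le> 2 * d) (at_right 0)"
    using eventually_at_right_less[of "0::real"] by eventually_elim simp
  then have "((\<lambda>d. (2 * d) powr (t - g) * C) \<longlongrightarrow> (2 * 0) powr (t - g) * C) (at_right 0)"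
    using \<open>g < t\<close> by (intro tendsto_intros) auto
  then have "((\<lambda>d. ennreal ((2 * d) powr (t - g) * C)) \<longlongrightarrow> ennreal ((2 * 0) powr (t - g) * C)) (at_right 0)"
    by (rule tendsto_ennrealI)
  then have lim: "((\<lambda>d. ennreal ((2 * d) powr (t - g) * C)) \<longlongrightarrow> 0) (at_right 0)"
    by simp
  have "packing_premeasure t A \<le> 0"
  proof (rule tendsto_lowerbound[OF lim])
    show "eventually (\<lambda>d. packing_premeasure t A \<le> ennreal ((2 * d) powr (t - g) * C)) (at_right 0)"
      using eventually_at_right_real[OF \<delta>(1)] by eventually_elim (auto intro: bound)
  qed simp
  then show ?thesis by simp
qed

text \<open>
  A ball centred in the closure contains the ball of half the radius around a nearby point of the
  set itself. Halving all radii therefore turns a packing of the closure into a packing of the set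
  and changes the gauge only by the factor \<open>2 powr g\<close>.
\<close>

lemma packing_premeasure_closure_finite:
  assumes fin: "packing_premeasure g A < \<top>"
  shows "packing_premeasure g (closure A) < \<top>"
proof -
  obtain \<delta> C where \<delta>: "0 < \<delta>" "0 \<le> C"
    and C: "\<And>P. P \<in> packings \<delta> A \<Longrightarrow> (\<Sum>(x, r)\<in>P. (2 * r) powr g) \<le> C"
    using packing_premeasure_finiteE[OF fin] by blast
  have "packing_premeasure g (closure A) \<le> ennreal (2 powr g * C)"
  proof (rule packing_premeasure_le[OF \<delta>(1)])
    fix P assume P: "P \<in> packings \<delta> (closure A)"
    have "\<forall>p\<in>P. \<exists>y. y \<in> A \<and> dist y (fst p) < snd p / 2"
    proof
      fix p assume "p \<in> P"
      then have "fst p \<in> closure A" "0 < snd p / 2" using P by (auto simp: packings_def)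
      then show "\<exists>y. y \<in> A \<and> dist y (fst p) < snd p / 2"
        unfolding closure_approachable by blast
    qed
    then obtain y where y: "\<And>p. p \<in> P \<Longrightarrow> y p \<in> A" "\<And>p. p \<in> P \<Longrightarrow> dist (y p) (fst p) < snd p / 2"
      by metis
    define h where "h p = (y p, snd p / 2)" for p
    have pos: "0 < snd p" "snd p \<le> \<delta>" if "p \<in> P" for p using that P by (auto simp: packings_def)
    have sub: "cball (y p) (snd p / 2) \<subseteq> cball (fst p) (snd p)" if "p \<in> P" for p
    proof
      fix z assume "z \<in> cball (y p) (snd p / 2)"
      then show "z \<in> cball (fst p) (snd p)"
        using y(2)[OF that] dist_triangle[of "fst p" z "y p"] by (simp add: dist_commute)
    qed
    have disj: "cball (y p) (snd p / 2) \<inter> cball (y q) (snd q / 2) = {}"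
      if "p \<in> P" "q \<in> P" "p \<noteq> q" for p q
    proof -
      have "cball (fst p) (snd p) \<inter> cball (fst q) (snd q) = {}"
        using P that by (auto simp: packings_def disjoint_family_on_def split_beta)
      then show ?thesis using sub[OF that(1)] sub[OF that(2)] by blast
    qed
    have inj: "inj_on h P"
    proof (rule inj_onI, rule ccontr)
      fix p q assume pq: "p \<in> P" "q \<in> P" "h p = h q" "p \<noteq> q"
      then have "y p \<in> cball (y p) (snd p / 2) \<inter> cball (y q) (snd q / 2)"
        using pos[of p] pos[of q] by (auto simp: h_def)
      then show False using disj[OF pq(1,2,4)] by blast
    qed
    have "h ` P \<in> packings \<delta> A"
      unfolding packings_def
    proof (intro CollectI conjI)
      show "finite (h ` P)" using P by (simp add: packings_def)
      show "\<forall>(x, r)\<in>h ` P. x \<in> A \<and> 0 < r \<and> r \<le> \<delta>"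
        using y(1) pos by (force simp: h_def)
      show "disjoint_family_on (\<lambda>(x, r). cball x r) (h ` P)"
        unfolding disjoint_family_on_def
      proof (intro ballI impI)
        fix u v assume "u \<in> h ` P" "v \<in> h ` P" "u \<noteq> v"
        then obtain p q where "p \<in> P" "q \<in> P" "p \<noteq> q" "u = h p" "v = h q" by blast
        then show "(case u of (x, r) \<Rightarrow> cball x r) \<inter> (case v of (x, r) \<Rightarrow> cball x r) = {}"
          using disj[of p q] by (simp add: h_def)
      qed
    qed
    then have "(\<Sum>(x, r)\<in>h ` P. (2 * r) powr g) \<le> C" by (rule C)
    also have "(\<Sum>(x, r)\<in>h ` P. (2 * r) powr g) = (\<Sum>(x, r)\<in>P. r powr g)"
      by (subst sum.reindex[OF inj]) (simp add: h_def case_prod_unfold o_def)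
    finally have le: "(\<Sum>(x, r)\<in>P. r powr g) \<le> C" .
    have "(\<Sum>(x, r)\<in>P. (2 * r) powr g) = (\<Sum>(x, r)\<in>P. 2 powr g * r powr g)"
      using pos by (intro sum.cong refl) (force simp: powr_mult)
    also have "\<dots> = 2 powr g * (\<Sum>(x, r)\<in>P. r powr g)"
      by (simp add: sum_distrib_left case_prod_unfold)
    also have "\<dots> \<le> 2 powr g * C" using le by (intro mult_left_mono) auto
    finally show "(\<Sum>(x, r)\<in>P. (2 * r) powr g) \<le> 2 powr g * C" .
  qed
  then show ?thesis using ennreal_less_top le_less_trans by blast
qed

text \<open>
  This property stands in for ``packing dimension at most \<open>g\<close>'': by \<open>packing_dim_le\<close> and
  \<open>packing_dim_ge\<close> below it decides the dimension up to the critical value, it is countably stable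
  by construction, and it speaks directly about the premeasure, hence about packings of a single
  set, which is what the probabilistic argument needs.
\<close>

definition packing_sigma_finite :: "real \<Rightarrow> 'x::metric_space set \<Rightarrow> bool" where
  "packing_sigma_finite g A \<longleftrightarrow>
     (\<exists>F :: nat \<Rightarrow> 'x set. A \<subseteq> (\<Union>i. F i) \<and> (\<forall>i. packing_premeasure g (F i) < \<top>))"

lemma packing_sigma_finite_subset:
  "packing_sigma_finite g B \<Longrightarrow> A \<subseteq> B \<Longrightarrow> packing_sigma_finite g A"
  unfolding packing_sigma_finite_def by blast

lemma packing_sigma_finite_if_premeasure:
  "packing_premeasure g A < \<top> \<Longrightarrow> packing_sigma_finite g A"
  unfolding packing_sigma_finite_def by (intro exI[of _ "\<lambda>_. A"]) auto

lemma packing_sigma_finite_UN: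
  fixes A :: "'i \<Rightarrow> 'x::metric_space set"
  assumes "countable I" "\<And>i. i \<in> I \<Longrightarrow> packing_sigma_finite g (A i)"
  shows "packing_sigma_finite g (\<Union>i\<in>I. A i)"
proof (cases "I = {}")
  case True
  then show ?thesis by (auto intro: packing_sigma_finite_if_premeasure)
next
  case False
  have "\<forall>i\<in>I. \<exists>F :: nat \<Rightarrow> 'x set. A i \<subseteq> (\<Union>j. F j) \<and> (\<forall>j. packing_premeasure g (F j) < \<top>)"
    using assms(2) unfolding packing_sigma_finite_def by blast
  from bchoice[OF this] obtain F :: "'i \<Rightarrow> nat \<Rightarrow> 'x set" where
    F: "\<And>i. i \<in> I \<Longrightarrow> A i \<subseteq> (\<Union>j. F i j)" "\<And>i j. i \<in> I \<Longrightarrow> packing_premeasure g (F i j) < \<top>"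
    by blast
  define H where "H n = F (from_nat_into I (fst (prod_decode n))) (snd (prod_decode n))" for n
  have "A i \<subseteq> (\<Union>n. H n)" if i: "i \<in> I" for i
  proof
    fix x assume "x \<in> A i"
    then obtain j where "x \<in> F i j" using F(1)[OF i] by blast
    then have "x \<in> H (prod_encode (to_nat_on I i, j))" using i assms(1) by (simp add: H_def)
    then show "x \<in> (\<Union>n. H n)" by blast
  qed
  then have "(\<Union>i\<in>I. A i) \<subseteq> (\<Union>n. H n)" by blast
  moreover have "packing_premeasure g (H n) < \<top>" for n
    unfolding H_def by (intro F(2) from_nat_into[OF False])
  ultimately show ?thesis unfolding packing_sigma_finite_def by blast
qed

lemma packing_dim_le:
  assumes "packing_sigma_finite g A" "0 \<le> g"
  shows "packing_dim A \<le> ereal g"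
proof (cases "A = {}")
  case True
  then show ?thesis by (simp add: packing_dim_def)
next
  case False
  obtain F :: "nat \<Rightarrow> 'a set" where F: "A \<subseteq> (\<Union>i. F i)" "\<And>i. packing_premeasure g (F i) < \<top>"
    using assms(1) unfolding packing_sigma_finite_def by blast
  have zero: "packing_measure t A = 0" if "g < t" for t
  proof -
    have "packing_measure t A \<le> (\<Sum>i. packing_premeasure t (F i))"
      unfolding packing_measure_def using F(1) by (intro INF_lower) simp
    also have "\<dots> = 0" using packing_premeasure_eq_0[OF F(2) that] by simp
    finally show ?thesis by simp
  qed
  have "packing_dim A \<le> ereal t" if "g < t" for t
    using zero[OF that] that assms(2) False by (auto simp: packing_dim_def intro!: Inf_lower)
  then show ?thesis
    by (intro ccontr[of "packing_dim A \<le> ereal g"]) (use ereal_dense2[of "ereal g" "packing_dim A"] in force)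
qed

lemma packing_dim_ge:
  assumes "\<not> packing_sigma_finite g A"
  shows "ereal g \<le> packing_dim A"
proof -
  have ne: "A \<noteq> {}"
    using assms by (auto intro: packing_sigma_finite_if_premeasure)
  have "ereal g \<le> ereal t" if t: "packing_measure t A = 0" for t
  proof (rule ccontr)
    assume "\<not> ereal g \<le> ereal t"
    then have "t \<le> g" by simp
    have "packing_measure t A < 1" using t by simp
    then obtain F :: "nat \<Rightarrow> 'a set" where F: "A \<subseteq> (\<Union>i. F i)" "(\<Sum>i. packing_premeasure t (F i)) < 1"
      unfolding packing_measure_def by (auto simp: INF_less_iff)
    have "packing_premeasure g (F i) < \<top>" for i
    proof (rule packing_premeasure_finite_mono[OF _ order_refl \<open>t \<le> g\<close>])
      have "packing_premeasure t (F i) = (\<Sum>j\<in>{i}. packing_premeasure t (F j))" by simp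
      also have "\<dots> \<le> (\<Sum>j. packing_premeasure t (F j))" by (rule sum_le_suminf) auto
      also have "\<dots> < \<top>" using F(2) by (rule less_trans) simp
      finally show "packing_premeasure t (F i) < \<top>" .
    qed
    then show False using assms F(1) unfolding packing_sigma_finite_def by blast
  qed
  then show ?thesis using ne by (auto simp: packing_dim_def intro!: Inf_greatest)
qed

section \<open>Separated sets in sets of infinite premeasure\<close>

text \<open>
  If at every fine scale \<open>b ^ k\<close> a separated subset of \<open>A\<close> had at most \<open>b powr (- k t)\<close> points, then
  splitting a packing according to the scale of its radii would bound its gauge sum by a constant
  times the geometric series with ratio \<open>b powr (g - t) < 1\<close>. Disjoint closed balls have centres
  further apart than either radius, so each group of a packing is a separated set.
\<close>

lemma infinite_premeasure_imp_separated_sets: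
  fixes A :: "'x::metric_space set"
  assumes inf: "\<not> packing_premeasure g A < \<top>" and b: "0 < b" "b < 1" and t: "0 \<le> t" "t < g"
  shows "\<exists>k S. K \<le> k \<and> finite S \<and> S \<subseteq> A \<and> b powr (- (real k * t)) \<le> real (card S) \<and>
    (\<forall>x\<in>S. \<forall>y\<in>S. x \<noteq> y \<longrightarrow> b ^ k < dist x y)" (is ?goal)
proof (rule ccontr)
  assume contra: "\<not> ?goal"
  have few: "real (card S) \<le> b powr (- (real k * t))"
    if "K \<le> k" "finite S" "S \<subseteq> A" "\<And>x y. x \<in> S \<Longrightarrow> y \<in> S \<Longrightarrow> x \<noteq> y \<Longrightarrow> b ^ k < dist x y" for k S
  proof (rule ccontr)
    assume "\<not> real (card S) \<le> b powr (- (real k * t))"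
    then have ?goal using that by (intro exI[of _ k] exI[of _ S]) auto
    then show False using contra by contradiction
  qed
  define q where "q = b powr (g - t)"
  have q: "0 < q" "q < 1" using b t by (auto simp: q_def powr01_less_one)
  define D where "D = (2 / b) powr g"
  have "packing_premeasure g A \<le> ennreal (D * (1 / (1 - q)))"
  proof (rule packing_premeasure_le)
    show "0 < b ^ K" using b by simp
    fix P assume P: "P \<in> packings (b ^ K) A"
    then have fin: "finite P" by (simp add: packings_def)
    have pos: "fst p \<in> A" "0 < snd p" "snd p \<le> b ^ K" if "p \<in> P" for p
      using P that by (auto simp: packings_def)
    \<comment> \<open>\<open>\<kappa> p\<close> is the scale of the ball: \<open>b ^ \<kappa> p \<le> radius \<le> b ^ (\<kappa> p - 1)\<close>\<close>
    define \<kappa> where "\<kappa> p = nat \<lceil>log b (snd p)\<rceil>" for p :: "'x \<times> real"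
    have \<kappa>: "K \<le> \<kappa> p" "b ^ \<kappa> p \<le> snd p" "snd p \<le> b ^ \<kappa> p / b" if p: "p \<in> P" for p
    proof -
      have "ln (snd p) \<le> ln (b ^ K)" using b pos[OF p] by simp
      then have L: "real K \<le> log b (snd p)"
        using b by (simp add: log_def neg_le_divide_eq ln_realpow)
      then show "K \<le> \<kappa> p" unfolding \<kappa>_def by linarith
      have ge: "log b (snd p) \<le> real (\<kappa> p)" and le: "real (\<kappa> p) \<le> log b (snd p) + 1"
        unfolding \<kappa>_def using L by linarith+
      have "b powr real (\<kappa> p) \<le> b powr log b (snd p)" using ge b by (intro powr_mono') auto
      then show "b ^ \<kappa> p \<le> snd p" using b pos[OF p] by (simp add: powr_realpow)
      have "b powr (log b (snd p) + 1) \<le> b powr real (\<kappa> p)" using le b by (intro powr_mono') auto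
      then show "snd p \<le> b ^ \<kappa> p / b" using b pos[OF p] by (simp add: powr_realpow powr_add field_simps)
    qed
    have disj: "cball (fst p) (snd p) \<inter> cball (fst p') (snd p') = {}"
      if "p \<in> P" "p' \<in> P" "p \<noteq> p'" for p p'
      using P that by (auto simp: packings_def disjoint_family_on_def split_beta)
    have "fst p \<noteq> fst p'" if "p \<in> P" "p' \<in> P" "p \<noteq> p'" for p p'
      using disj[OF that] pos(2)[OF that(1)] pos(2)[OF that(2)] by (metis IntI centre_in_cball empty_iff less_imp_le)
    then have inj: "inj_on fst P" by (auto simp: inj_on_def)
    have group: "(\<Sum>p\<in>{p\<in>P. \<kappa> p = k}. (2 * snd p) powr g) \<le> D * q ^ k" if k: "k \<in> \<kappa> ` P" for k
    proof -
      let ?Q = "{p\<in>P. \<kappa> p = k}"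
      have "inj_on fst ?Q" using inj by (rule inj_on_subset) auto
      then have "real (card ?Q) = real (card (fst ` ?Q))" by (simp add: card_image)
      also have "\<dots> \<le> b powr (- (real k * t))"
      proof (rule few)
        show "K \<le> k" using k \<kappa>(1) by blast
        show "finite (fst ` ?Q)" using fin by simp
        show "fst ` ?Q \<subseteq> A" using pos by auto
        fix x y assume "x \<in> fst ` ?Q" "y \<in> fst ` ?Q" "x \<noteq> y"
        then obtain p p' where p: "p \<in> P" "p' \<in> P" "\<kappa> p = k" "x = fst p" "y = fst p'" "p \<noteq> p'" by blast
        then have "y \<notin> cball x (snd p)"
          using disj[OF p(1,2,6)] pos(2)[OF p(2)] by (metis IntI centre_in_cball empty_iff less_imp_le)
        then show "b ^ k < dist x y" using \<kappa>(2)[OF p(1)] p by simp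
      qed
      finally have card: "real (card ?Q) \<le> b powr (- (real k * t))" .
      have "(\<Sum>p\<in>?Q. (2 * snd p) powr g) \<le> (\<Sum>p\<in>?Q. (2 * (b ^ k / b)) powr g)"
      proof (intro sum_mono powr_mono2)
        fix p assume p: "p \<in> ?Q"
        then show "2 * snd p \<le> 2 * (b ^ k / b)" "0 \<le> 2 * snd p"
          using \<kappa>(3)[of p] pos(2)[of p] by auto
      qed (use t in simp)
      also have "\<dots> = real (card ?Q) * (2 * (b ^ k / b)) powr g" by simp
      also have "\<dots> \<le> b powr (- (real k * t)) * (2 * (b ^ k / b)) powr g"
        using card by (intro mult_right_mono) auto
      also have "2 * (b ^ k / b) = (2 / b) * b powr real k"
        using b by (simp add: powr_realpow)
      also have "((2 / b) * b powr real k) powr g = D * b powr (real k * g)"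
        unfolding D_def using b by (subst powr_mult) (simp_all add: powr_powr)
      also have "b powr (- (real k * t)) * (D * b powr (real k * g)) = D * b powr (- (real k * t) + real k * g)"
        by (subst powr_add) simp
      also have "- (real k * t) + real k * g = (g - t) * real k" by (simp add: algebra_simps)
      also have "b powr ((g - t) * real k) = q ^ k"
        using powr_realpow[OF q(1), of k] by (simp add: q_def powr_powr)
      finally show ?thesis .
    qed
    have "(\<Sum>(x, r)\<in>P. (2 * r) powr g) = (\<Sum>k\<in>\<kappa> ` P. \<Sum>p\<in>{p\<in>P. \<kappa> p = k}. (2 * snd p) powr g)"
      unfolding case_prod_unfold using fin by (rule sum.image_gen)
    also have "\<dots> \<le> (\<Sum>k\<in>\<kappa> ` P. D * q ^ k)" by (intro sum_mono group)
    also have "\<dots> = D * (\<Sum>k\<in>\<kappa> ` P. q ^ k)" by (simp add: sum_distrib_left)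
    also have "\<dots> \<le> D * (1 / (1 - q))"
    proof (rule mult_left_mono)
      have "(\<Sum>k\<in>\<kappa> ` P. q ^ k) \<le> (\<Sum>k. q ^ k)"
        using q fin by (intro sum_le_suminf summable_geometric) auto
      also have "\<dots> = 1 / (1 - q)" using q by (intro suminf_geometric) auto
      finally show "(\<Sum>k\<in>\<kappa> ` P. q ^ k) \<le> 1 / (1 - q)" .
    qed (simp add: D_def)
    finally show "(\<Sum>(x, r)\<in>P. (2 * r) powr g) \<le> D * (1 / (1 - q))" .
  qed
  then show False using inf ennreal_less_top le_less_trans by blast
qed

text \<open>
  Scales with many separated points need not occur among the \<open>k i\<close>. Rounding such a scale up to the
  next \<open>k i\<close> enlarges it by a factor close to \<open>1\<close> and thus changes exponents only slightly.
\<close>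

lemma ratio_tendsto_1_imp_dense:
  fixes k :: "nat \<Rightarrow> nat"
  assumes pos: "\<And>i. 0 < k i" and top: "filterlim k at_top sequentially"
    and lim: "(\<lambda>i. real (k (Suc i)) / real (k i)) \<longlonglongrightarrow> 1" and "0 < \<delta>"
  obtains q0 where "\<And>q. q0 \<le> q \<Longrightarrow> \<exists>i\<ge>i0. q \<le> k i \<and> real (k i) \<le> (1 + \<delta>) * real q"
proof -
  have "eventually (\<lambda>i. real (k (Suc i)) / real (k i) < 1 + \<delta>) sequentially"
    using lim \<open>0 < \<delta>\<close> by (intro order_tendstoD) auto
  then obtain i1 where i1: "\<And>i. i1 \<le> i \<Longrightarrow> real (k (Suc i)) / real (k i) < 1 + \<delta>"
    by (auto simp: eventually_sequentially)
  define m where "m = max i0 i1"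
  have "\<exists>i\<ge>i0. q \<le> k i \<and> real (k i) \<le> (1 + \<delta>) * real q" if q: "Suc (k m) \<le> q" for q
  proof -
    have "eventually (\<lambda>i. q \<le> k i \<and> m \<le> i) sequentially"
      using top eventually_ge_at_top[of m] by (auto simp: filterlim_at_top eventually_conj_iff)
    then obtain j where j: "q \<le> k j" "m \<le> j" by (auto simp: eventually_sequentially)
    define i where "i = (LEAST i. m \<le> i \<and> q \<le> k i)"
    have i: "m \<le> i" "q \<le> k i" unfolding i_def using LeastI[of "\<lambda>i. m \<le> i \<and> q \<le> k i" j] j by auto
    have "i \<noteq> m" using i q by auto
    then obtain j' where j': "i = Suc j'" "m \<le> j'" using i(1) by (cases i) auto
    have "k j' < q"
      using not_less_Least[of j' "\<lambda>i. m \<le> i \<and> q \<le> k i"] j' unfolding i_def[symmetric] by auto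
    have "real (k i) \<le> (1 + \<delta>) * real (k j')"
      using i1[of j'] j' pos[of j'] by (simp add: m_def field_simps)
    also have "\<dots> \<le> (1 + \<delta>) * real q" using \<open>k j' < q\<close> \<open>0 < \<delta>\<close> by (intro mult_left_mono) auto
    finally show ?thesis using i by (intro exI[of _ i]) (auto simp: m_def)
  qed
  then show ?thesis using that by blast
qed

section \<open>Second moments under exponential mixing\<close>

lemma stationary_pair:
  fixes \<xi> :: "nat \<Rightarrow> 'w \<Rightarrow> 'x::metric_space"
  assumes st: "stationary_process M \<xi>" and "1 \<le> i" "1 \<le> j"
    and U: "U \<in> sets borel" and V: "V \<in> sets borel"
  shows "measure M {\<omega>\<in>space M. \<xi> (i + k) \<omega> \<in> U \<and> \<xi> (j + k) \<omega> \<in> V} =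
         measure M {\<omega>\<in>space M. \<xi> i \<omega> \<in> U \<and> \<xi> j \<omega> \<in> V}"
proof -
  let ?P = "PiM {1::nat..} (\<lambda>_. borel :: 'x measure)"
  let ?X = "\<lambda>k \<omega>. \<lambda>n\<in>{1..}. \<xi> (n + k) \<omega>"
  let ?S = "{f \<in> space ?P. f i \<in> U \<and> f j \<in> V}"
  have meas: "\<xi> n \<in> borel_measurable M" if "1 \<le> n" for n
    using st that by (simp add: stationary_process_def)
  have X: "?X k \<in> measurable M ?P" for k
    by (rule measurable_restrict) (simp add: meas)
  have [measurable]: "(\<lambda>f. f i) \<in> measurable ?P borel" "(\<lambda>f. f j) \<in> measurable ?P borel"
    using assms(2,3) by (auto intro: measurable_component_singleton)
  have S: "?S \<in> sets ?P" using U V by measurable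
  have eq: "measure M {\<omega>\<in>space M. \<xi> (i + k) \<omega> \<in> U \<and> \<xi> (j + k) \<omega> \<in> V} = measure (distr M ?P (?X k)) ?S" for k
  proof -
    have "?X k -` ?S \<inter> space M = {\<omega>\<in>space M. \<xi> (i + k) \<omega> \<in> U \<and> \<xi> (j + k) \<omega> \<in> V}"
      using assms(2,3) measurable_space[OF X[of k]] by auto
    then show ?thesis using measure_distr[OF X S] by simp
  qed
  have "distr M ?P (?X k) = distr M ?P (?X 0)"
    using st by (simp add: stationary_process_def)
  then show ?thesis using eq[of k] eq[of 0] by simp
qed

text \<open>
  The upper half of the mixing estimate, multiplied out so that it covers null conditioning events.
\<close>

lemma (in prob_space) exponentially_mixingE:
  assumes "exponentially_mixing M \<xi>" and meas: "\<And>n. 1 \<le> n \<Longrightarrow> \<xi> n \<in> borel_measurable M"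
  obtains C \<rho> where "0 < C" "0 < \<rho>" "\<rho> < 1"
    "\<And>n x r V. 1 \<le> n \<Longrightarrow> 0 < r \<Longrightarrow> V \<in> sets borel \<Longrightarrow>
       prob {\<omega>\<in>space M. \<xi> 1 \<omega> \<in> cball x r \<and> \<xi> (1 + n) \<omega> \<in> V} \<le>
       (prob {\<omega>\<in>space M. \<xi> 1 \<omega> \<in> cball x r} + C * \<rho> ^ n) * prob {\<omega>\<in>space M. \<xi> (1 + n) \<omega> \<in> V}"
proof -
  obtain C \<rho> where C: "0 < C" "0 < \<rho>" "\<rho> < 1"
    and mix: "\<And>n x r D. 1 \<le> n \<Longrightarrow> D \<in> future_events M \<xi> (n + 1) \<Longrightarrow> 0 < r \<Longrightarrow> 0 < prob D \<Longrightarrow>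
      \<bar>\<P>(\<omega> in M. \<xi> 1 \<omega> \<in> cball x r \<bar> \<omega> \<in> D) - \<P>(\<omega> in M. \<xi> 1 \<omega> \<in> cball x r)\<bar> \<le> C * \<rho> ^ n"
    using assms(1) unfolding exponentially_mixing_def by blast
  have "prob {\<omega>\<in>space M. \<xi> 1 \<omega> \<in> cball x r \<and> \<xi> (1 + n) \<omega> \<in> V} \<le>
       (prob {\<omega>\<in>space M. \<xi> 1 \<omega> \<in> cball x r} + C * \<rho> ^ n) * prob {\<omega>\<in>space M. \<xi> (1 + n) \<omega> \<in> V}"
    if n: "1 \<le> n" "0 < r" and V: "V \<in> sets borel" for n x r V
  proof -
    define D where "D = {\<omega>\<in>space M. \<xi> (1 + n) \<omega> \<in> V}"
    have [measurable]: "\<xi> (1 + n) \<in> borel_measurable M" using n by (intro meas) simp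
    have D[measurable]: "D \<in> events" unfolding D_def using V by measurable
    have "D = \<xi> (1 + n) -` V \<inter> space M" by (auto simp: D_def)
    then have fut: "D \<in> future_events M \<xi> (n + 1)"
      unfolding future_events_def using V by (intro sigma_sets.Basic) (auto intro!: bexI[of _ "1 + n"])
    have sub: "{\<omega>\<in>space M. \<xi> 1 \<omega> \<in> cball x r \<and> \<xi> (1 + n) \<omega> \<in> V} = {\<omega>\<in>space M. \<xi> 1 \<omega> \<in> cball x r \<and> \<omega> \<in> D}"
      by (auto simp: D_def)
    show ?thesis
    proof (cases "0 < prob D")
      case True
      have "{\<omega>\<in>space M. \<omega> \<in> D} = D" using sets.sets_into_space[OF D] by auto
      then have "prob {\<omega>\<in>space M. \<xi> 1 \<omega> \<in> cball x r \<and> \<omega> \<in> D} / prob D \<le>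
          prob {\<omega>\<in>space M. \<xi> 1 \<omega> \<in> cball x r} + C * \<rho> ^ n"
        using mix[OF n(1) fut n(2) True, of x] unfolding cond_prob_def by simp
      then show ?thesis using True unfolding sub D_def[symmetric] by (simp add: pos_divide_le_eq)
    next
      case False
      then have "prob D = 0" using measure_nonneg[of M D] by linarith
      moreover have "prob {\<omega>\<in>space M. \<xi> 1 \<omega> \<in> cball x r \<and> \<omega> \<in> D} \<le> prob D"
        by (intro finite_measure_mono D) auto
      ultimately show ?thesis unfolding sub D_def[symmetric] by simp
    qed
  qed
  then show ?thesis using that[OF C] by blast
qed

text \<open>
  Chebyshev's inequality for the number of events that occur: its mean is \<open>card I * p\<close>, and since
  the covariances are dominated by a summable function of the lag, its variance is at most
  \<open>2 * T\<close> times the mean.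
\<close>

lemma (in prob_space) second_moment_bound:
  fixes A :: "nat \<Rightarrow> 'a set" and \<theta> :: "nat \<Rightarrow> real"
  assumes I: "finite I" "I \<noteq> {}" and A: "\<And>i. i \<in> I \<Longrightarrow> A i \<in> events"
    and p: "\<And>i. i \<in> I \<Longrightarrow> prob (A i) = p" "0 < p"
    and cov: "\<And>i j. i \<in> I \<Longrightarrow> j \<in> I \<Longrightarrow> i < j \<Longrightarrow> prob (A i \<inter> A j) \<le> p\<^sup>2 + p * \<theta> (j - i)"
    and \<theta>: "1 \<le> \<theta> 0" "\<And>g. 0 \<le> \<theta> g" "\<And>J. finite J \<Longrightarrow> sum \<theta> J \<le> T"
  shows "prob (space M - (\<Union>i\<in>I. A i)) \<le> 2 * T / (real (card I) * p)"
proof -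
  define m where "m = real (card I) * p"
  have m: "0 < m" using I p(2) by (simp add: m_def card_gt_0_iff)
  define Z where "Z \<omega> = (\<Sum>i\<in>I. indicat_real (A i) \<omega>)" for \<omega>
  have intA: "integrable M (indicat_real (A i))" if "i \<in> I" for i
    using A[OF that] by (simp add: emeasure_eq_measure)
  have intAA: "integrable M (indicat_real (A i \<inter> A j))" if "i \<in> I" "j \<in> I" for i j
    using A that by (simp add: emeasure_eq_measure sets.Int)
  have EZ: "integrable M Z" "expectation Z = m"
    unfolding Z_def using intA A p(1) by (auto simp: m_def Bochner_Integration.integral_sum)
  have Z2: "Z \<omega> ^ 2 = (\<Sum>i\<in>I. \<Sum>j\<in>I. indicat_real (A i \<inter> A j) \<omega>)" for \<omega>
    by (simp add: Z_def power2_eq_square sum_product indicator_inter_arith)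
  have EZ2: "integrable M (\<lambda>\<omega>. Z \<omega> ^ 2)"
    "expectation (\<lambda>\<omega>. Z \<omega> ^ 2) = (\<Sum>i\<in>I. \<Sum>j\<in>I. prob (A i \<inter> A j))"
    unfolding Z2 using intAA A by (auto simp: Bochner_Integration.integral_sum sets.Int intro!: sum.cong)
  have row: "(\<Sum>j\<in>I. prob (A i \<inter> A j)) \<le> real (card I) * p\<^sup>2 + p * (2 * T)" if i: "i \<in> I" for i
  proof -
    have "prob (A i \<inter> A j) \<le> p\<^sup>2 + p * \<theta> (if i \<le> j then j - i else i - j)" if j: "j \<in> I" for j
    proof -
      consider "i < j" | "j < i" | "i = j" by linarith
      then show ?thesis
      proof cases
        case 1
        then show ?thesis using cov[OF i j] by simp
      next
        case 2
        then show ?thesis using cov[OF j i] by (simp add: Int_commute)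
      next
        case 3
        have "p * 1 \<le> p * \<theta> 0" using \<theta>(1) p(2) by (intro mult_left_mono) auto
        then show ?thesis using 3 p(1)[OF i] by (simp add: add_increasing)
      qed
    qed
    then have "(\<Sum>j\<in>I. prob (A i \<inter> A j)) \<le> (\<Sum>j\<in>I. p\<^sup>2 + p * \<theta> (if i \<le> j then j - i else i - j))"
      by (intro sum_mono)
    also have "\<dots> = real (card I) * p\<^sup>2 + p * (\<Sum>j\<in>I. \<theta> (if i \<le> j then j - i else i - j))"
      by (simp add: sum.distrib sum_distrib_left)
    also have "(\<Sum>j\<in>I. \<theta> (if i \<le> j then j - i else i - j)) =
        (\<Sum>j\<in>{j\<in>I. i \<le> j}. \<theta> (j - i)) + (\<Sum>j\<in>{j\<in>I. \<not> i \<le> j}. \<theta> (i - j))"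
      using I(1) by (simp add: if_distrib[of \<theta>] sum.If_cases Int_def Collect_neg_eq)
    also have "(\<Sum>j\<in>{j\<in>I. i \<le> j}. \<theta> (j - i)) = sum \<theta> ((\<lambda>j. j - i) ` {j\<in>I. i \<le> j})"
      by (subst sum.reindex) (auto simp: inj_on_def)
    also have "(\<Sum>j\<in>{j\<in>I. \<not> i \<le> j}. \<theta> (i - j)) = sum \<theta> ((\<lambda>j. i - j) ` {j\<in>I. \<not> i \<le> j})"
      by (subst sum.reindex) (auto simp: inj_on_def)
    also have "sum \<theta> ((\<lambda>j. j - i) ` {j\<in>I. i \<le> j}) + sum \<theta> ((\<lambda>j. i - j) ` {j\<in>I. \<not> i \<le> j}) \<le> 2 * T"
      using \<theta>(3)[of "(\<lambda>j. j - i) ` {j\<in>I. i \<le> j}"] \<theta>(3)[of "(\<lambda>j. i - j) ` {j\<in>I. \<not> i \<le> j}"] I(1) by simp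
    finally show ?thesis using p(2) by simp
  qed
  have "expectation (\<lambda>\<omega>. Z \<omega> ^ 2) \<le> (\<Sum>i\<in>I. real (card I) * p\<^sup>2 + p * (2 * T))"
    unfolding EZ2 by (intro sum_mono row)
  also have "\<dots> = m\<^sup>2 + m * (2 * T)" by (simp add: m_def algebra_simps power2_eq_square)
  finally have sm: "expectation (\<lambda>\<omega>. Z \<omega> ^ 2) \<le> m\<^sup>2 + m * (2 * T)" .
  let ?N = "space M - (\<Union>i\<in>I. A i)"
  have N: "?N \<in> events" using I A by (intro sets.Diff sets.finite_UN) auto
  have var: "(\<lambda>\<omega>. (Z \<omega> - m)\<^sup>2) = (\<lambda>\<omega>. Z \<omega> ^ 2 - 2 * m * Z \<omega> + m\<^sup>2)"
    by (auto simp: power2_diff algebra_simps)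
  have intv: "integrable M (\<lambda>\<omega>. (Z \<omega> - m)\<^sup>2)"
    unfolding var using EZ(1) EZ2(1) by auto
  have "m\<^sup>2 * prob ?N = expectation (\<lambda>\<omega>. m\<^sup>2 * indicat_real ?N \<omega>)"
    using N by simp
  also have "\<dots> \<le> expectation (\<lambda>\<omega>. (Z \<omega> - m)\<^sup>2)"
  proof (rule integral_mono[OF _ intv])
    show "integrable M (\<lambda>\<omega>. m\<^sup>2 * indicat_real ?N \<omega>)" using N by (simp add: emeasure_eq_measure)
    show "m\<^sup>2 * indicat_real ?N \<omega> \<le> (Z \<omega> - m)\<^sup>2" for \<omega>
    proof (cases "\<omega> \<in> ?N")
      case True
      then have "Z \<omega> = 0" unfolding Z_def by (intro sum.neutral) auto
      then show ?thesis using True by simp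
    qed simp
  qed
  also have "\<dots> = expectation (\<lambda>\<omega>. Z \<omega> ^ 2) - m\<^sup>2"
    unfolding var using EZ EZ2(1) by (simp add: power2_eq_square prob_space)
  also have "\<dots> \<le> m * (2 * T)" using sm by simp
  finally have "m * prob ?N \<le> 2 * T" using m by (simp add: power2_eq_square mult.assoc)
  then show ?thesis using m unfolding m_def[symmetric] by (simp add: pos_le_divide_eq mult.commute)
qed

text \<open>
  The prefactor \<open>Q\<close> will be huge, as it counts balls. Cutting at the lag \<open>h\<close>, where \<open>\<rho> ^ h\<close> has
  absorbed it, replaces the bound \<open>Q / (1 - \<rho>)\<close> by one that is logarithmic in \<open>Q\<close>.
\<close>

lemma sum_min_geometric_le:
  fixes \<rho> Q :: real
  assumes "0 < \<rho>" "\<rho> < 1" "0 \<le> Q" "finite J"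
  shows "(\<Sum>g\<in>J. min 1 (Q * \<rho> ^ g)) \<le> real h + Q * \<rho> ^ h / (1 - \<rho>)"
proof -
  have "(\<Sum>g\<in>J. min 1 (Q * \<rho> ^ g)) = (\<Sum>g\<in>{g\<in>J. g < h}. min 1 (Q * \<rho> ^ g)) + (\<Sum>g\<in>{g\<in>J. \<not> g < h}. min 1 (Q * \<rho> ^ g))"
    using \<open>finite J\<close> by (subst sum.union_disjoint[symmetric]) (auto intro!: sum.cong)
  also have "(\<Sum>g\<in>{g\<in>J. g < h}. min 1 (Q * \<rho> ^ g)) \<le> (\<Sum>g\<in>{g\<in>J. g < h}. 1)"
    by (intro sum_mono) simp
  also have "\<dots> \<le> real h"
    using card_mono[of "{..<h}" "{g\<in>J. g < h}"] by auto
  also have "(\<Sum>g\<in>{g\<in>J. \<not> g < h}. min 1 (Q * \<rho> ^ g)) \<le> (\<Sum>g\<in>{g\<in>J. \<not> g < h}. Q * \<rho> ^ h * \<rho> ^ (g - h))"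
    by (intro sum_mono) (auto simp: mult.assoc simp flip: power_add)
  also have "\<dots> = Q * \<rho> ^ h * (\<Sum>g\<in>{g\<in>J. \<not> g < h}. \<rho> ^ (g - h))"
    by (simp add: sum_distrib_left)
  also have "(\<Sum>g\<in>{g\<in>J. \<not> g < h}. \<rho> ^ (g - h)) = (\<Sum>g\<in>(\<lambda>g. g - h) ` {g\<in>J. \<not> g < h}. \<rho> ^ g)"
    by (subst sum.reindex) (auto simp: inj_on_def)
  also have "\<dots> \<le> (\<Sum>g. \<rho> ^ g)"
    using assms by (intro sum_le_suminf summable_geometric) auto
  also have "\<dots> = 1 / (1 - \<rho>)" using assms by (intro suminf_geometric) auto
  finally show ?thesis using assms by (simp add: mult_left_mono)
qed

text \<open>
  The mixing condition controls single balls only; for a union of \<open>card S\<close> disjoint balls the errors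
  add up. The covariance at lag \<open>g\<close> is thus at most \<open>p * (card S * C * \<rho> ^ g)\<close>, and trivially at
  most \<open>p\<close>; the minimum of the two feeds the second moment bound.
\<close>

lemma (in prob_space) miss_prob_le:
  fixes \<xi> :: "nat \<Rightarrow> 'a \<Rightarrow> 'x::metric_space"
  assumes st: "stationary_process M \<xi>" and \<rho>: "0 < C" "0 < \<rho>" "\<rho> < 1"
    and mix: "\<And>n x r V. 1 \<le> n \<Longrightarrow> 0 < r \<Longrightarrow> V \<in> sets borel \<Longrightarrow>
       prob {\<omega>\<in>space M. \<xi> 1 \<omega> \<in> cball x r \<and> \<xi> (1 + n) \<omega> \<in> V} \<le>
       (prob {\<omega>\<in>space M. \<xi> 1 \<omega> \<in> cball x r} + C * \<rho> ^ n) * prob {\<omega>\<in>space M. \<xi> (1 + n) \<omega> \<in> V}"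
    and I: "finite I" "I \<noteq> {}" "\<And>n. n \<in> I \<Longrightarrow> 1 \<le> n"
    and S: "finite S" "0 < r" "disjoint_family_on (\<lambda>x. cball x r) S"
    and p: "p = (\<Sum>x\<in>S. prob {\<omega>\<in>space M. \<xi> 1 \<omega> \<in> cball x r})" "0 < p"
  shows "prob {\<omega>\<in>space M. \<forall>n\<in>I. \<forall>x\<in>S. \<xi> n \<omega> \<notin> cball x r} \<le>
         2 * (real h + (1 + real (card S) * C) * \<rho> ^ h / (1 - \<rho>)) / (real (card I) * p)"
proof -
  define U where "U = (\<Union>x\<in>S. cball x r)"
  have U[measurable]: "U \<in> sets borel" unfolding U_def using S(1) by (intro sets.finite_UN) auto
  have meas: "\<xi> n \<in> borel_measurable M" if "1 \<le> n" for n
    using st that by (simp add: stationary_process_def)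
  define A where "A n = {\<omega>\<in>space M. \<xi> n \<omega> \<in> U}" for n
  have ev: "{\<omega>\<in>space M. \<xi> n \<omega> \<in> V} \<in> events" if "1 \<le> n" "V \<in> sets borel" for n V
    using measurable_sets[OF meas[OF that(1)] that(2)] by (simp add: vimage_def Int_def conj_commute)
  have A: "A n \<in> events" if "1 \<le> n" for n unfolding A_def using that U by (rule ev)
  have ball: "prob {\<omega>\<in>space M. \<xi> 1 \<omega> \<in> U \<and> Q \<omega>} = (\<Sum>x\<in>S. prob {\<omega>\<in>space M. \<xi> 1 \<omega> \<in> cball x r \<and> Q \<omega>})"
    if "{\<omega>\<in>space M. Q \<omega>} \<in> events" for Q
  proof -
    have "{\<omega>\<in>space M. \<xi> 1 \<omega> \<in> U \<and> Q \<omega>} = (\<Union>x\<in>S. {\<omega>\<in>space M. \<xi> 1 \<omega> \<in> cball x r \<and> Q \<omega>})"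
      by (auto simp: U_def)
    moreover have "{\<omega>\<in>space M. \<xi> 1 \<omega> \<in> cball x r \<and> Q \<omega>} \<in> events" for x
      using sets.Int[OF ev[of 1 "cball x r"] that] by (simp add: Int_def conj_ac) 
    moreover have "disjoint_family_on (\<lambda>x. {\<omega>\<in>space M. \<xi> 1 \<omega> \<in> cball x r \<and> Q \<omega>}) S"
      using S(3) unfolding disjoint_family_on_def by blast
    ultimately show ?thesis using finite_measure_finite_Union[OF S(1)] by (simp add: image_subset_iff)
  qed
  have p1: "prob (A 1) = p"
    using ball[of "\<lambda>_. True"] by (simp add: A_def p(1))
  have pn: "prob (A n) = p" if "1 \<le> n" for n
    using stationary_pair[OF st order_refl order_refl U U, of "n - 1"] that p1 by (simp add: A_def)
  \<comment> \<open>the summand \<open>1\<close> makes the truncated weight at lag \<open>0\<close> equal to \<open>1\<close>\<close>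
  define Q where "Q = 1 + real (card S) * C"
  have Q: "0 \<le> Q" "real (card S) * C \<le> Q" "1 \<le> Q" using \<rho> by (auto simp: Q_def)
  have cov: "prob (A i \<inter> A j) \<le> p\<^sup>2 + p * min 1 (Q * \<rho> ^ (j - i))" if "1 \<le> i" "i < j" for i j
  proof -
    define n where "n = j - i"
    have n: "1 \<le> n" "(1 + n) + (i - 1) = j" "1 + (i - 1) = i" using that by (auto simp: n_def)
    have "A i \<inter> A j = {\<omega>\<in>space M. \<xi> (1 + (i - 1)) \<omega> \<in> U \<and> \<xi> ((1 + n) + (i - 1)) \<omega> \<in> U}"
      unfolding n(2,3) by (auto simp: A_def)
    then have "prob (A i \<inter> A j) = prob {\<omega>\<in>space M. \<xi> 1 \<omega> \<in> U \<and> \<xi> (1 + n) \<omega> \<in> U}"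
      using stationary_pair[OF st order_refl _ U U, of "1 + n" "i - 1"] by simp
    also have "\<dots> = (\<Sum>x\<in>S. prob {\<omega>\<in>space M. \<xi> 1 \<omega> \<in> cball x r \<and> \<xi> (1 + n) \<omega> \<in> U})"
      by (rule ball) (auto intro!: ev U)
    also have "\<dots> \<le> (\<Sum>x\<in>S. (prob {\<omega>\<in>space M. \<xi> 1 \<omega> \<in> cball x r} + C * \<rho> ^ n) * p)"
      using mix[OF n(1) S(2) U] pn[of "1 + n"] by (intro sum_mono) (simp add: A_def)
    also have "\<dots> = (\<Sum>x\<in>S. prob {\<omega>\<in>space M. \<xi> 1 \<omega> \<in> cball x r} + C * \<rho> ^ n) * p"
      by (simp add: sum_distrib_right)
    also have "\<dots> = p\<^sup>2 + p * (real (card S) * C * \<rho> ^ n)"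
      by (simp only: sum.distrib p(1)[symmetric]) (simp add: power2_eq_square algebra_simps)
    also have "\<dots> \<le> p\<^sup>2 + p * (Q * \<rho> ^ n)"
      using p(2) Q(2) \<rho> by (intro add_left_mono mult_left_mono mult_right_mono) auto
    finally have 1: "prob (A i \<inter> A j) \<le> p\<^sup>2 + p * (Q * \<rho> ^ n)" .
    have "prob (A i \<inter> A j) \<le> prob (A i)" using A that by (intro finite_measure_mono) auto
    also have "\<dots> \<le> p\<^sup>2 + p * 1" using pn that by simp
    finally show ?thesis using 1 unfolding n_def[symmetric] by (auto simp: min_def)
  qed
  have "prob (space M - (\<Union>i\<in>I. A i)) \<le> 2 * (real h + Q * \<rho> ^ h / (1 - \<rho>)) / (real (card I) * p)"
  proof (rule second_moment_bound[where \<theta> = "\<lambda>g. min 1 (Q * \<rho> ^ g)"])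
    show "(\<Sum>g\<in>J. min 1 (Q * \<rho> ^ g)) \<le> real h + Q * \<rho> ^ h / (1 - \<rho>)" if "finite J" for J
      using \<rho> Q that by (intro sum_min_geometric_le) auto
    show "prob (A i \<inter> A j) \<le> p\<^sup>2 + p * min 1 (Q * \<rho> ^ (j - i))" if "i \<in> I" "j \<in> I" "i < j" for i j
      using that by (intro cov I(3))
    show "1 \<le> min 1 (Q * \<rho> ^ 0)" using Q by simp
    show "0 \<le> min 1 (Q * \<rho> ^ g)" for g using Q \<rho> by simp
    show "A i \<in> events" "prob (A i) = p" if "i \<in> I" for i
      using A pn I(3)[OF that] by auto
  qed (fact I(1), fact I(2), fact p(2))
  moreover have "space M - (\<Union>i\<in>I. A i) = {\<omega>\<in>space M. \<forall>n\<in>I. \<forall>x\<in>S. \<xi> n \<omega> \<notin> cball x r}"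
    by (auto simp: A_def U_def)
  ultimately show ?thesis by (simp add: Q_def)
qed

section \<open>Hitting probabilities of the random balls\<close>

lemma ext_log_liminf_imp_count_ge:
  assumes lim: "(\<lambda>i. ext_log (inverse b) (N i) / ereal (real (k i))) \<longlonglongrightarrow> ereal \<alpha>"
    and b: "0 < b" "b < 1" and "a < \<alpha>" and k: "\<And>i. 0 < k i"
  shows "eventually (\<lambda>i. b powr (- (real (k i) * a)) \<le> real (N i)) sequentially"
proof -
  have "eventually (\<lambda>i. ereal a < ext_log (inverse b) (N i) / ereal (real (k i))) sequentially"
    using lim \<open>a < \<alpha>\<close> by (intro order_tendstoD) auto
  then show ?thesis
  proof eventually_elim
    case (elim i)
    have ki: "0 < real (k i)" using k by simp
    then have N: "N i \<noteq> 0" using elim by (auto simp: ext_log_def divide_ereal_def split: if_splits)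
    then have "a < log (inverse b) (real (N i)) / real (k i)"
      using elim ki by (simp add: ext_log_def)
    then have "real (k i) * a \<le> log (inverse b) (real (N i))"
      using ki by (simp add: field_simps)
    then have "inverse b powr (real (k i) * a) \<le> inverse b powr log (inverse b) (real (N i))"
      using b by (intro powr_mono) (auto simp: one_le_inverse_iff)
    also have "\<dots> = real (N i)" using N b by (intro powr_log_cancel) auto
    also have "inverse b powr (real (k i) * a) = b powr (- (real (k i) * a))"
      using b by (simp add: powr_minus inverse_powr)
    finally show ?case .
  qed
qed

text \<open>
  At a scale \<open>K = k i\<close>, about \<open>b powr (- K \<alpha>)\<close> of the random balls have radius at least \<open>b ^ (K - 1)\<close>,
  and \<open>A\<close> contains about \<open>b powr (- K \<gamma>)\<close> points that are \<open>b ^ K\<close>-separated. Regularity gives the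
  union of the disjoint balls of radius \<open>b ^ K / 3\<close> around these points measure about
  \<open>b powr (K (s - \<gamma>))\<close>, so the expected number of centres falling into it is about
  \<open>b powr (- K (\<gamma> + \<alpha> - s))\<close>, which grows exponentially in \<open>K\<close>. The relative variance is of the order
  of \<open>K\<close> divided by this mean, so the probability of a miss tends to \<open>0\<close> along such scales.
\<close>

lemma (in prob_space) covering_hits_large_set:
  fixes \<xi> :: "nat \<Rightarrow> 'a \<Rightarrow> 'x::metric_space"
  assumes cpt: "compact (UNIV :: 'x set)"
    and st: "stationary_process M \<xi>" and em: "exponentially_mixing M \<xi>"
    and s: "0 < s" and ahl: "ahlfors_regular s (distr M borel (\<xi> 1))"
    and l: "\<And>n. 1 \<le> n \<Longrightarrow> 0 < l n"
    and \<alpha>: "\<alpha> < s" and b: "0 < b" "b < 1"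
    and k: "\<And>i. 0 < k i" "filterlim k at_top sequentially"
      "(\<lambda>i. real (k (Suc i)) / real (k i)) \<longlonglongrightarrow> 1"
    and lim: "(\<lambda>i. ext_log (inverse b) (scale_count b l (k i)) / ereal (real (k i))) \<longlonglongrightarrow> ereal \<alpha>"
    and \<gamma>: "s - \<alpha> < \<gamma>" and A: "\<not> packing_premeasure \<gamma> A < \<top>"
  shows "AE \<omega> in M. \<exists>n\<ge>m. 1 \<le> n \<and> (\<exists>a\<in>A. dist (\<xi> n \<omega>) a < l n)"
proof -
  have meas: "\<xi> n \<in> borel_measurable M" if "1 \<le> n" for n
    using st that by (simp add: stationary_process_def)
  obtain C \<rho> where \<rho>: "0 < C" "0 < \<rho>" "\<rho> < 1"
    and mix: "\<And>n x r V. 1 \<le> n \<Longrightarrow> 0 < r \<Longrightarrow> V \<in> sets borel \<Longrightarrow>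
       prob {\<omega>\<in>space M. \<xi> 1 \<omega> \<in> cball x r \<and> \<xi> (1 + n) \<omega> \<in> V} \<le>
       (prob {\<omega>\<in>space M. \<xi> 1 \<omega> \<in> cball x r} + C * \<rho> ^ n) * prob {\<omega>\<in>space M. \<xi> (1 + n) \<omega> \<in> V}"
    using exponentially_mixingE[OF em meas] by blast
  obtain c where c: "1 \<le> c" and reg: "\<And>x r. 0 < r \<Longrightarrow> r \<le> diameter (UNIV :: 'x set) \<Longrightarrow>
      inverse c * r powr s \<le> measure (distr M borel (\<xi> 1)) (cball x r)"
    using ahl unfolding ahlfors_regular_def by blast
  have low: "inverse c * r powr s \<le> prob {\<omega>\<in>space M. \<xi> 1 \<omega> \<in> cball x r}"
    if "0 < r" "r \<le> diameter (UNIV :: 'x set)" for x r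
  proof -
    have "\<xi> 1 -` cball x r \<inter> space M = {\<omega>\<in>space M. \<xi> 1 \<omega> \<in> cball x r}" by auto
    then show ?thesis using reg[OF that, of x] by (subst (asm) measure_distr) (auto intro: meas)
  qed
  \<comment> \<open>the surplus \<open>\<gamma> + \<alpha> - s\<close> is split into four parts: three pay for the losses in the exponents of the\<close>
  \<comment> \<open>number of points, the rounding of the scale and the number of radii, and the last one remains\<close>
  define \<eta> where "\<eta> = (\<gamma> - (s - \<alpha>)) / 4"
  define t where "t = \<gamma> - \<eta>"
  define \<delta> where "\<delta> = \<eta> / t"
  have \<eta>: "0 < \<eta>" using \<gamma> by (simp add: \<eta>_def)
  have t: "0 < t" "t < \<gamma>" "\<eta> < t" using \<gamma> \<alpha> by (auto simp: t_def \<eta>_def field_simps)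
  have \<delta>: "0 < \<delta>" using \<eta> t by (simp add: \<delta>_def)
  have t\<delta>: "(t - \<eta>) * (1 + \<delta>) \<le> t"
  proof -
    have "(t - \<eta>) * (1 + \<delta>) = t - \<eta> * \<delta>" using t by (simp add: \<delta>_def field_simps)
    then show ?thesis using \<eta> \<delta> by simp
  qed
  \<comment> \<open>the cutoff lag at scale \<open>K\<close> will be \<open>K * h\<close>; at most about \<open>b powr (- K s)\<close> disjoint balls fit\<close>
  obtain h where h: "\<rho> ^ h \<le> b powr s"
  proof -
    have "0 < b powr s" using b by simp
    then have "\<exists>h. \<rho> ^ h < b powr s" using \<rho> by (intro real_arch_pow_inv) auto
    then show ?thesis using that less_imp_le by blast
  qed
  \<comment> \<open>\<open>c0 * b powr (K s)\<close> bounds from below the measure of a ball of radius \<open>b ^ K / 3\<close>\<close>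
  define c0 where "c0 = inverse c * (1 / 3) powr s"
  have c0: "0 < c0" using c by (simp add: c0_def)
  define Q where "Q = (1 + C / c0) / (1 - \<rho>)"
  define err where "err j = 2 / c0 * (real j * real h + Q) * (b powr \<eta>) ^ j" for j :: nat
  have err: "err \<longlonglongrightarrow> 0"
  proof -
    have z: "norm (b powr \<eta>) < 1" using b \<eta> by (simp add: powr01_less_one)
    have "(\<lambda>j. 2 / c0 * (real h * (real j * (b powr \<eta>) ^ j) + Q * (b powr \<eta>) ^ j)) \<longlonglongrightarrow>
        2 / c0 * (real h * 0 + Q * 0)"
      by (intro tendsto_add tendsto_mult_left powser_times_n_limit_0[OF z] LIMSEQ_power_zero[OF z])
    then show ?thesis unfolding err_def by (simp add: algebra_simps)
  qed
  define Hit where "Hit = {\<omega>\<in>space M. \<exists>n\<ge>m. 1 \<le> n \<and> (\<exists>a\<in>A. dist (\<xi> n \<omega>) a < l n)}"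
  have Hit: "Hit \<in> events"
  proof -
    have "Hit = (\<Union>n\<in>{n. m \<le> n \<and> 1 \<le> n}. \<xi> n -` (\<Union>a\<in>A. ball a (l n)) \<inter> space M)"
      by (rule set_eqI) (simp add: Hit_def dist_commute, blast)
    also have "\<dots> \<in> events"
      by (intro sets.countable_UN'' measurable_sets[OF meas] borel_open open_UN) auto
    finally show ?thesis .
  qed
  have "1 \<le> prob Hit + e" if "0 < e" for e
  proof -
    have "eventually (\<lambda>j. b ^ (j - 2) < l n) sequentially" if "1 \<le> n" for n
    proof -
      have "(\<lambda>j. b ^ (j - 2)) \<longlonglongrightarrow> 0"
        by (rule LIMSEQ_offset[where k = 2]) (use b in \<open>simp add: LIMSEQ_power_zero\<close>)
      then show ?thesis using l[OF that] by (intro order_tendstoD) auto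
    qed
    then have "eventually (\<lambda>j. \<forall>n\<in>{1..<m}. b ^ (j - 2) < l n) sequentially"
      by (intro eventually_ball_finite) auto
    moreover have "eventually (\<lambda>j. err j < e) sequentially"
      using err \<open>0 < e\<close> by (rule order_tendstoD)
    ultimately have "eventually (\<lambda>j. (\<forall>n\<in>{1..<m}. b ^ (j - 2) < l n) \<and> err j < e \<and> 2 \<le> j) sequentially"
      using eventually_ge_at_top[of 2] by eventually_elim auto
    then have "eventually (\<lambda>i. (\<forall>n\<in>{1..<m}. b ^ (k i - 2) < l n) \<and> err (k i) < e \<and> 2 \<le> k i) sequentially"
      using k(2) by (rule eventually_compose_filterlim)
    moreover have "eventually (\<lambda>i. b powr (- (real (k i) * (\<alpha> - \<eta>))) \<le> real (scale_count b l (k i))) sequentially"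
      using lim b \<eta> k(1) by (intro ext_log_liminf_imp_count_ge) auto
    ultimately have "eventually (\<lambda>i. ((\<forall>n\<in>{1..<m}. b ^ (k i - 2) < l n) \<and> err (k i) < e \<and> 2 \<le> k i) \<and>
        b powr (- (real (k i) * (\<alpha> - \<eta>))) \<le> real (scale_count b l (k i))) sequentially"
      by (rule eventually_conj)
    then obtain i0 where i0: "\<And>i n. i0 \<le> i \<Longrightarrow> n \<in> {1..<m} \<Longrightarrow> b ^ (k i - 2) < l n"
      "\<And>i. i0 \<le> i \<Longrightarrow> err (k i) < e" "\<And>i. i0 \<le> i \<Longrightarrow> 2 \<le> k i"
      "\<And>i. i0 \<le> i \<Longrightarrow> b powr (- (real (k i) * (\<alpha> - \<eta>))) \<le> real (scale_count b l (k i))"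
      unfolding eventually_sequentially by blast
    obtain q0 where q0: "\<And>q. q0 \<le> q \<Longrightarrow> \<exists>i\<ge>i0. q \<le> k i \<and> real (k i) \<le> (1 + \<delta>) * real q"
      using ratio_tendsto_1_imp_dense[OF k \<delta>, of i0] by blast
    obtain q S where q: "max q0 1 \<le> q" and S: "finite S" "S \<subseteq> A" "b powr (- (real q * t)) \<le> real (card S)"
      and sep: "\<And>x y. x \<in> S \<Longrightarrow> y \<in> S \<Longrightarrow> x \<noteq> y \<Longrightarrow> b ^ q < dist x y"
      using infinite_premeasure_imp_separated_sets[OF A b less_imp_le[OF t(1)] t(2), of "max q0 1"] by blast
    obtain i where i: "i0 \<le> i" "q \<le> k i" "real (k i) \<le> (1 + \<delta>) * real q"
      using q0[of q] q by auto
    define K where "K = k i"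
    have K: "2 \<le> K" using i0(3)[OF i(1)] by (simp add: K_def)
    have sepK: "b ^ K < dist x y" if "x \<in> S" "y \<in> S" "x \<noteq> y" for x y
      by (rule le_less_trans[OF power_decreasing[OF i(2)[folded K_def]] sep[OF that]]) (use b in auto)
    define r where "r = b ^ K / 3"
    have r: "0 < r" using b by (simp add: r_def)
    have Kq: "real K * (t - \<eta>) \<le> real q * t"
    proof -
      have "real K * (t - \<eta>) \<le> ((1 + \<delta>) * real q) * (t - \<eta>)"
        using i(3) t by (intro mult_right_mono) (auto simp: K_def)
      also have "\<dots> = real q * ((t - \<eta>) * (1 + \<delta>))" by simp
      also have "\<dots> \<le> real q * t" using t\<delta> by (intro mult_left_mono) auto
      finally show ?thesis .
    qed
    have cardS: "b powr (- (real K * (t - \<eta>))) \<le> real (card S)"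
      using Kq b by (intro order_trans[OF powr_mono' S(3)]) auto
    \<comment> \<open>regularity concerns radii up to the diameter, which two distinct points of \<open>S\<close> bound from below\<close>
    have "1 < b powr (- (real q * t))"
    proof -
      have "b powr (real q * t) < 1" using b q t by (simp add: powr01_less_one)
      then show ?thesis using b by (simp add: powr_minus one_less_inverse_iff)
    qed
    then have "2 \<le> card S" using S(3) by linarith
    then obtain x y where xy: "x \<in> S" "y \<in> S" "x \<noteq> y"
      by (metis card_le_Suc0_iff_eq S(1) not_less_eq_eq numeral_2_eq_2)
    have rd: "r \<le> diameter (UNIV :: 'x set)"
    proof -
      have "dist x y \<le> diameter (UNIV :: 'x set)"
        by (rule diameter_bounded_bound[OF compact_imp_bounded[OF cpt]]) auto
      then show ?thesis using sepK[OF xy] r by (simp add: r_def)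
    qed
    have disj: "disjoint_family_on (\<lambda>x. cball x r) S"
      unfolding disjoint_family_on_def
    proof (intro ballI impI)
      fix x y assume "x \<in> S" "y \<in> S" "x \<noteq> y"
      then have "3 * r < dist x y" using sepK by (simp add: r_def)
      then have "z \<notin> cball y r" if "z \<in> cball x r" for z
        using that dist_triangle[of x y z] r by (simp add: dist_commute)
      then show "cball x r \<inter> cball y r = {}" by blast
    qed
    define p where "p = (\<Sum>x\<in>S. prob {\<omega>\<in>space M. \<xi> 1 \<omega> \<in> cball x r})"
    have rs: "inverse c * r powr s = c0 * b powr (real K * s)"
    proof -
      have "r = (1 / 3) * b powr real K" using b by (simp add: r_def powr_realpow)
      then have "r powr s = (1 / 3) powr s * b powr (real K * s)"
        using b by (simp only: powr_mult powr_powr)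
      then show ?thesis by (simp add: c0_def)
    qed
    have pS: "real (card S) * (c0 * b powr (real K * s)) \<le> p"
    proof -
      have "(\<Sum>x\<in>S. inverse c * r powr s) \<le> p" unfolding p_def by (intro sum_mono low r rd)
      then show ?thesis by (simp add: rs)
    qed
    have "0 < real (card S) * (c0 * b powr (real K * s))" using \<open>2 \<le> card S\<close> c0 b by simp
    then have p: "0 < p" using pS by linarith
    have "p \<le> 1"
    proof -
      have "p = prob (\<Union>x\<in>S. {\<omega>\<in>space M. \<xi> 1 \<omega> \<in> cball x r})"
        unfolding p_def
      proof (rule finite_measure_finite_Union[symmetric, OF S(1)])
        show "(\<lambda>x. {\<omega>\<in>space M. \<xi> 1 \<omega> \<in> cball x r}) ` S \<subseteq> events"
          using measurable_sets[OF meas[OF order_refl], of "cball _ r"]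
          by (auto simp: vimage_def Int_def conj_commute)
        show "disjoint_family_on (\<lambda>x. {\<omega>\<in>space M. \<xi> 1 \<omega> \<in> cball x r}) S"
          using disj unfolding disjoint_family_on_def by blast
      qed
      then show ?thesis by simp
    qed
    then have card_le: "real (card S) * b powr (real K * s) \<le> 1 / c0"
      using pS c0 by (simp add: field_simps)
    define I where "I = {n. 1 \<le> n \<and> l n \<in> {b powi (int K - 1) ..< b powi (int K - 2)}}"
    have cardI: "b powr (- (real K * (\<alpha> - \<eta>))) \<le> real (card I)"
      using i0(4)[OF i(1)] by (simp add: scale_count_def I_def K_def)
    moreover have "0 < b powr (- (real K * (\<alpha> - \<eta>)))" using b by simp
    ultimately have "0 < card I" by linarith
    then have I: "finite I" "I \<noteq> {}" by (auto simp: card_gt_0_iff)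
    have In: "1 \<le> n" "m \<le> n" "r < l n" if n: "n \<in> I" for n
    proof -
      have "b powi (int K - 1) = b ^ (K - 1)" "b powi (int K - 2) = b ^ (K - 2)"
        using K by (auto simp: power_int_def nat_diff_distrib)
      then have ln: "1 \<le> n" "b ^ (K - 1) \<le> l n" "l n < b ^ (K - 2)" using n by (auto simp: I_def)
      show "1 \<le> n" by fact
      show "m \<le> n" using i0(1)[OF i(1), of n] ln by (force simp: K_def)
      have "b ^ K \<le> b ^ (K - 1)" using b by (intro power_decreasing) auto
      moreover have "r < b ^ K" using b by (simp add: r_def)
      ultimately show "r < l n" using ln by linarith
    qed
    have sub: "space M - Hit \<subseteq> {\<omega>\<in>space M. \<forall>n\<in>I. \<forall>x\<in>S. \<xi> n \<omega> \<notin> cball x r}"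
      using In S(2) by (fastforce simp: Hit_def dist_commute)
    have Miss: "{\<omega>\<in>space M. \<forall>n\<in>I. \<forall>x\<in>S. \<xi> n \<omega> \<notin> cball x r} \<in> events"
    proof -
      have "{\<omega>\<in>space M. \<forall>n\<in>I. \<forall>x\<in>S. \<xi> n \<omega> \<notin> cball x r} =
          space M - (\<Union>n\<in>I. \<Union>x\<in>S. \<xi> n -` cball x r \<inter> space M)" by auto
      also have "\<dots> \<in> events"
        using I(1) S(1) In(1) by (intro sets.Diff sets.top sets.finite_UN measurable_sets[OF meas]) auto
      finally show ?thesis .
    qed
    have "prob (space M - Hit) \<le> prob {\<omega>\<in>space M. \<forall>n\<in>I. \<forall>x\<in>S. \<xi> n \<omega> \<notin> cball x r}"
      by (intro finite_measure_mono sub Miss)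
    also have "\<dots> \<le> 2 * (real (K * h) + (1 + real (card S) * C) * \<rho> ^ (K * h) / (1 - \<rho>)) / (real (card I) * p)"
      by (rule miss_prob_le[OF st \<rho> mix I In(1) S(1) r disj p_def p])
    also have "\<dots> \<le> 2 * (real K * real h + Q) / (c0 * b powr (- (real K * \<eta>)))"
    proof (rule frac_le)
      have "\<rho> ^ (K * h) \<le> b powr (real K * s)"
      proof -
        have "(\<rho> ^ h) ^ K \<le> (b powr s) ^ K" using h \<rho> by (intro power_mono) auto
        also have "(b powr s) ^ K = b powr (real K * s)"
          using b by (simp add: powr_powr mult.commute flip: powr_realpow)
        finally show ?thesis by (simp add: mult.commute flip: power_mult)
      qed
      then have "(1 + real (card S) * C) * \<rho> ^ (K * h) \<le> (1 + real (card S) * C) * b powr (real K * s)"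
        using \<rho> by (intro mult_left_mono) auto
      also have "\<dots> = b powr (real K * s) + C * (real (card S) * b powr (real K * s))"
        by (simp add: algebra_simps)
      also have "\<dots> \<le> 1 + C * (1 / c0)"
        using card_le \<rho> b s by (intro add_mono mult_left_mono powr_le1) auto
      finally have "(1 + real (card S) * C) * \<rho> ^ (K * h) / (1 - \<rho>) \<le> Q"
        using \<rho> by (auto simp: Q_def intro: divide_right_mono)
      then show "2 * (real (K * h) + (1 + real (card S) * C) * \<rho> ^ (K * h) / (1 - \<rho>)) \<le> 2 * (real K * real h + Q)"
        by simp
      show "0 \<le> 2 * (real K * real h + Q)" using \<rho> c0 by (simp add: Q_def)
      show "0 < c0 * b powr (- (real K * \<eta>))" using c0 b by simp
      have "c0 * b powr (- (real K * \<eta>)) =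
          b powr (- (real K * (\<alpha> - \<eta>))) * (b powr (- (real K * (t - \<eta>))) * (c0 * b powr (real K * s)))"
      proof -
        have "- (real K * \<eta>) = - (real K * (\<alpha> - \<eta>)) + (- (real K * (t - \<eta>)) + real K * s)"
          by (simp add: t_def \<eta>_def field_simps)
        then show ?thesis by (simp only: powr_add) (simp add: mult_ac)
      qed
      also have "\<dots> \<le> real (card I) * (real (card S) * (c0 * b powr (real K * s)))"
        using cardI cardS c0 by (intro mult_mono) auto
      also have "\<dots> \<le> real (card I) * p" using pS by (intro mult_left_mono) auto
      finally show "c0 * b powr (- (real K * \<eta>)) \<le> real (card I) * p" .
    qed
    also have "\<dots> = err K"
    proof -
      have "(b powr \<eta>) ^ K = b powr (real K * \<eta>)"
        using b by (simp add: powr_powr mult.commute flip: powr_realpow)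
      then show ?thesis using c0 b by (simp add: err_def powr_minus field_simps)
    qed
    also have "\<dots> < e" using i0(2)[OF i(1)] by (simp add: K_def)
    finally show ?thesis using prob_compl[OF Hit] by simp
  qed
  then have "1 \<le> prob Hit" by (rule field_le_epsilon)
  then have "prob Hit = 1" using prob_le_1[of Hit] by linarith
  then have "AE \<omega> in M. \<omega> \<in> Hit" using prob_eq_1[OF Hit] by simp
  then show ?thesis by (auto simp: Hit_def)
qed

section \<open>Category arguments in the Baire space\<close>

lemma completely_metrizable_baire_space:
  "completely_metrizable_space (euclidean :: (nat \<Rightarrow> nat) topology)"
proof -
  have "(euclidean :: nat topology) = discrete_topology UNIV"
    by (simp add: topology_eq Topological_Spaces.open_discrete)
  then have "completely_metrizable_space (product_topology (\<lambda>_::nat. euclidean :: nat topology) UNIV)"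
    by (simp add: completely_metrizable_space_product_topology completely_metrizable_space_discrete_topology)
  then show ?thesis by (simp add: euclidean_product_topology)
qed

text \<open>
  The Baire category theorem in the form used below: a nonempty closed set that is covered by
  countably many closed sets lies inside one of them on a nonempty relatively open part.
\<close>

lemma baire_countable_union:
  fixes F :: "(nat \<Rightarrow> nat) set"
  assumes "closed F" "F \<noteq> {}" and cl: "\<And>n::nat. closed (H n)" and cover: "F \<subseteq> (\<Union>n. H n)"
  obtains n U where "open U" "U \<inter> F \<noteq> {}" "U \<inter> F \<subseteq> H n"
proof (rule ccontr)
  assume contra: "\<not> thesis"
  let ?X = "top_of_set F"
  have "completely_metrizable_space ?X"
    using assms(1) by (intro completely_metrizable_space_closedin completely_metrizable_baire_space) auto
  moreover have "closedin ?X (F \<inter> H n) \<and> ?X interior_of (F \<inter> H n) = {}" for n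
  proof
    show "closedin ?X (F \<inter> H n)" using cl by (intro closedin_closed_Int)
    show "?X interior_of (F \<inter> H n) = {}"
    proof (rule ccontr)
      assume ne: "?X interior_of (F \<inter> H n) \<noteq> {}"
      have "openin ?X (?X interior_of (F \<inter> H n))" by simp
      then obtain U where U: "open U" "?X interior_of (F \<inter> H n) = F \<inter> U"
        unfolding openin_open by blast
      then have "U \<inter> F \<noteq> {}" "U \<inter> F \<subseteq> H n"
        using ne interior_of_subset[of ?X "F \<inter> H n"] by auto
      then show False using contra that U(1) by blast
    qed
  qed
  ultimately have "?X interior_of (\<Union>(range (\<lambda>n. F \<inter> H n))) = {}"
    by (intro Baire_category_alt) auto
  moreover have "\<Union>(range (\<lambda>n. F \<inter> H n)) = F" using cover by auto
  ultimately show False using interior_of_topspace[of ?X] \<open>F \<noteq> {}\<close> by simp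
qed

text \<open>
  As in the Cantor-Bendixson theorem: discarding all basic open sets with \<open>\<sigma>\<close>-finite image removes
  only countably many of them, so what remains is nowhere locally \<open>\<sigma>\<close>-finite. Working with the
  parametrisation, and not in the analytic set itself, provides a completely metrizable space.
\<close>

lemma analytic_kernel:
  fixes f :: "(nat \<Rightarrow> nat) \<Rightarrow> 'x::metric_space"
  assumes "\<not> packing_sigma_finite g (range f)"
  obtains F where "closed F" "F \<noteq> {}"
    "\<And>U. open U \<Longrightarrow> U \<inter> F \<noteq> {} \<Longrightarrow> \<not> packing_sigma_finite g (f ` (U \<inter> F))"
proof -
  obtain \<B> :: "(nat \<Rightarrow> nat) set set" where \<B>: "countable \<B>" "topological_basis \<B>"
    using ex_countable_basis by blast
  define W where "W = {U\<in>\<B>. packing_sigma_finite g (f ` U)}"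
  have W: "countable W" using \<B>(1) by (simp add: W_def)
  have opn: "open U" if "U \<in> \<B>" for U using \<B>(2) that by (rule topological_basis_open)
  have small: "packing_sigma_finite g (\<Union>U\<in>W. f ` U)"
    using W by (rule packing_sigma_finite_UN) (simp add: W_def)
  show ?thesis
  proof
    show "closed (- \<Union>W)" using opn by (auto simp: W_def closed_def)
    show "- \<Union>W \<noteq> {}"
    proof
      assume "- \<Union>W = {}"
      then have "range f \<subseteq> (\<Union>U\<in>W. f ` U)" by blast
      then show False using small assms packing_sigma_finite_subset by blast
    qed
    show "\<not> packing_sigma_finite g (f ` (U \<inter> - \<Union>W))" if U: "open U" "U \<inter> - \<Union>W \<noteq> {}" for U
    proof
      assume sm: "packing_sigma_finite g (f ` (U \<inter> - \<Union>W))"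
      obtain x where x: "x \<in> U" "x \<notin> \<Union>W" using U(2) by blast
      obtain V where V: "V \<in> \<B>" "x \<in> V" "V \<subseteq> U" using topological_basisE[OF \<B>(2) U(1) x(1)] by blast
      have "packing_sigma_finite g (\<Union>b. if b then f ` (U \<inter> - \<Union>W) else (\<Union>U\<in>W. f ` U))"
        using sm small by (intro packing_sigma_finite_UN) auto
      then have "packing_sigma_finite g (f ` V)"
      proof (rule packing_sigma_finite_subset)
        show "f ` V \<subseteq> (\<Union>b. if b then f ` (U \<inter> - \<Union>W) else (\<Union>U\<in>W. f ` U))"
          using V(3) unfolding UNIV_bool by auto blast
      qed
      then show False using V x by (auto simp: W_def)
    qed
  qed
qed

text \<open>
  The limsup set pulls back to a countable intersection of open subsets of \<open>F\<close>, and \<open>hit\<close> says that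
  they are dense. If the pieces of a \<open>\<sigma>\<close>-finite cover of the limsup set are replaced by their
  closures, then their preimages and the complements of these open sets cover \<open>F\<close> by closed sets.
  One of them contains a relatively open part of \<open>F\<close>; for a complement this contradicts density, and for a
  preimage the local largeness \<open>big\<close>.
\<close>

lemma limsup_not_sigma_finite:
  fixes f :: "(nat \<Rightarrow> nat) \<Rightarrow> 'x::metric_space"
  assumes f: "continuous_on UNIV f" and F: "closed F" "F \<noteq> {}"
    and big: "\<And>U. open U \<Longrightarrow> U \<inter> F \<noteq> {} \<Longrightarrow> \<not> packing_sigma_finite g (f ` (U \<inter> F))"
    and B: "topological_basis \<B>"
    and hit: "\<And>m U. U \<in> \<B> \<Longrightarrow> U \<inter> F \<noteq> {} \<Longrightarrow> \<exists>n\<ge>m. 1 \<le> n \<and> (\<exists>a\<in>f ` (U \<inter> F). dist (\<xi> n \<omega>) a < l n)"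
  shows "\<not> packing_sigma_finite g (covering_set \<xi> l \<omega> \<inter> range f)"
proof
  assume "packing_sigma_finite g (covering_set \<xi> l \<omega> \<inter> range f)"
  then obtain D :: "nat \<Rightarrow> 'x set" where D: "covering_set \<xi> l \<omega> \<inter> range f \<subseteq> (\<Union>i. D i)"
    and fin: "\<And>i. packing_premeasure g (D i) < \<top>"
    unfolding packing_sigma_finite_def by blast
  define N where "N m = (\<Union>n\<in>{n. m \<le> n \<and> 1 \<le> n}. ball (\<xi> n \<omega>) (l n))" for m
  have opn: "open (N m)" for m by (auto simp: N_def)
  have lim: "y \<in> covering_set \<xi> l \<omega>" if "\<And>m. y \<in> N m" for y
  proof -
    have "\<exists>n\<ge>m. 1 \<le> n \<and> y \<in> cball (\<xi> n \<omega>) (l n)" for m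
      using that[of m] by (force simp: N_def)
    then show ?thesis unfolding covering_set_def infinite_nat_iff_unbounded_le by blast
  qed
  \<comment> \<open>the two countable families of closed sets, interleaved\<close>
  define H where "H n = (if even n then f -` (- N (n div 2)) else f -` closure (D (n div 2)))" for n
  have "closed (H n)" for n
    unfolding H_def using opn by (auto intro!: closed_vimage f simp: closed_Compl)
  moreover have "F \<subseteq> (\<Union>n. H n)"
  proof
    fix x assume "x \<in> F"
    show "x \<in> (\<Union>n. H n)"
    proof (cases "\<forall>m. f x \<in> N m")
      case True
      then obtain i where "f x \<in> D i" using lim D by blast
      then have "x \<in> H (2 * i + 1)" using closure_subset by (auto simp: H_def)
      then show ?thesis by blast
    next
      case False
      then obtain m where "f x \<notin> N m" by blast
      then have "x \<in> H (2 * m)" by (simp add: H_def)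
      then show ?thesis by blast
    qed
  qed
  ultimately obtain n U where U: "open U" "U \<inter> F \<noteq> {}" "U \<inter> F \<subseteq> H n"
    using baire_countable_union[OF F] by metis
  show False
  proof (cases "even n")
    case True
    obtain x where x: "x \<in> U" "x \<in> F" using U(2) by blast
    obtain V where V: "V \<in> \<B>" "x \<in> V" "V \<subseteq> U" using topological_basisE[OF B U(1) x(1)] by blast
    obtain k a where k: "n div 2 \<le> k" "1 \<le> k" "a \<in> V \<inter> F" "dist (\<xi> k \<omega>) (f a) < l k"
      using hit[OF V(1), of "n div 2"] V x by blast
    then have "f a \<in> N (n div 2)" by (auto simp: N_def)
    moreover have "a \<in> H n" using k V U(3) by blast
    ultimately show False using True by (simp add: H_def)
  next
    case False
    then have "f ` (U \<inter> F) \<subseteq> closure (D (n div 2))" using U(3) by (auto simp: H_def)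
    moreover have "packing_sigma_finite g (closure (D (n div 2)))"
      by (intro packing_sigma_finite_if_premeasure packing_premeasure_closure_finite fin)
    ultimately show False using big[OF U(1,2)] packing_sigma_finite_subset by blast
  qed
qed

section \<open>Packing dimension of the limsup set\<close>

theorem theorem2p3:
  fixes M :: "'w measure"
    and \<xi> :: "nat \<Rightarrow> 'w \<Rightarrow> 'x::metric_space"
    and \<mu> :: "'x measure"
    and l :: "nat \<Rightarrow> real"
    and k :: "nat \<Rightarrow> nat"
    and s \<alpha> b :: real
  assumes "compact (UNIV :: 'x set)"
    and "prob_space M"
    and "stationary_process M \<xi>"
    and "exponentially_mixing M \<xi>"
    and "\<mu> = distr M borel (\<xi> 1)"
    and "0 < s"
    and "ahlfors_regular s \<mu>"
    and "\<And>n. 1 \<le> n \<Longrightarrow> 0 < l n"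
    and "antimono_on {1..} l"
    and "l \<longlonglongrightarrow> 0"
    and "\<alpha> = upper_bt_index s l"
    and "\<alpha> < s"
    and "0 < b" and "b < 1 / 3"
    and "incseq k"
    and "\<And>i. 0 < k i"
    and "filterlim k at_top sequentially"
    and "(\<lambda>i. real (k (Suc i)) / real (k i)) \<longlonglongrightarrow> 1"
    and "(\<lambda>i. ext_log (inverse b) (scale_count b l (k i)) / ereal (real (k i))) \<longlonglongrightarrow> ereal \<alpha>"
  shows "\<forall>G :: 'x set. analytic_set G \<longrightarrow> packing_dim G > ereal (s - \<alpha>) \<longrightarrow>
           (AE \<omega> in M. covering_set \<xi> l \<omega> \<inter> G \<noteq> {}) \<and>
           (AE \<omega> in M. packing_dim (covering_set \<xi> l \<omega> \<inter> G) = packing_dim G)"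
proof (intro allI impI)
  fix G :: "'x set"
  assume G: "analytic_set G" "ereal (s - \<alpha>) < packing_dim G"
  interpret prob_space M by fact
  have "G \<noteq> {}" using G(2) by (auto simp: packing_dim_def)
  then obtain f :: "(nat \<Rightarrow> nat) \<Rightarrow> 'x" where f: "continuous_on UNIV f" "range f = G"
    using G(1) unfolding analytic_set_def by blast
  obtain \<B> :: "(nat \<Rightarrow> nat) set set" where \<B>: "countable \<B>" "topological_basis \<B>"
    using ex_countable_basis by blast
  \<comment> \<open>each \<open>g\<close> has its own null set; rational values suffice for the dimension in the end\<close>
  have below: "AE \<omega> in M. ereal g \<le> packing_dim (covering_set \<xi> l \<omega> \<inter> G)"
    if g: "s - \<alpha> < g" "ereal g < packing_dim G" for g
  proof -
    have "\<not> packing_sigma_finite g (range f)"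
      using packing_dim_le[of g G] g \<open>\<alpha> < s\<close> f(2) by (auto simp: not_le[symmetric])
    then obtain F where F: "closed F" "F \<noteq> {}"
      and big: "\<And>U. open U \<Longrightarrow> U \<inter> F \<noteq> {} \<Longrightarrow> \<not> packing_sigma_finite g (f ` (U \<inter> F))"
      using analytic_kernel by metis
    have hit: "AE \<omega> in M. \<exists>n\<ge>m. 1 \<le> n \<and> (\<exists>a\<in>f ` (U \<inter> F). dist (\<xi> n \<omega>) a < l n)"
      if U: "U \<in> {U\<in>\<B>. U \<inter> F \<noteq> {}}" for U m
    proof (rule covering_hits_large_set)
      show "\<not> packing_premeasure g (f ` (U \<inter> F)) < \<top>"
        using big[of U] U topological_basis_open[OF \<B>(2)] packing_sigma_finite_if_premeasure by blast
      show "ahlfors_regular s (distr M borel (\<xi> 1))" using assms(5,7) by simp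
    qed (use assms g in auto)
    have "AE \<omega> in M. \<forall>U\<in>{U\<in>\<B>. U \<inter> F \<noteq> {}}. \<forall>m. \<exists>n\<ge>m. 1 \<le> n \<and> (\<exists>a\<in>f ` (U \<inter> F). dist (\<xi> n \<omega>) a < l n)"
      using \<B>(1) hit by (subst AE_ball_countable) (auto simp: AE_all_countable)
    then show ?thesis
    proof eventually_elim
      case (elim \<omega>)
      have "\<not> packing_sigma_finite g (covering_set \<xi> l \<omega> \<inter> range f)"
        using limsup_not_sigma_finite[OF f(1) F big \<B>(2), of \<xi> \<omega> l] elim by blast
      then show ?case using packing_dim_ge f(2) by blast
    qed
  qed
  have "AE \<omega> in M. \<forall>g\<in>{g\<in>\<rat>. s - \<alpha> < g \<and> ereal g < packing_dim G}. ereal g \<le> packing_dim (covering_set \<xi> l \<omega> \<inter> G)"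
    using below countable_rat by (subst AE_ball_countable) (auto intro: countable_subset)
  then have dim: "AE \<omega> in M. packing_dim (covering_set \<xi> l \<omega> \<inter> G) = packing_dim G"
  proof eventually_elim
    case (elim \<omega>)
    have "packing_dim G \<le> packing_dim (covering_set \<xi> l \<omega> \<inter> G)"
    proof (rule ccontr)
      assume "\<not> packing_dim G \<le> packing_dim (covering_set \<xi> l \<omega> \<inter> G)"
      then have "max (ereal (s - \<alpha>)) (packing_dim (covering_set \<xi> l \<omega> \<inter> G)) < packing_dim G"
        using G(2) by auto
      from ereal_dense3[OF this] obtain q
        where q: "ereal (s - \<alpha>) < ereal (real_of_rat q)" "ereal (real_of_rat q) < packing_dim G"
          and less: "packing_dim (covering_set \<xi> l \<omega> \<inter> G) < ereal (real_of_rat q)"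
        by (auto simp only: max_less_iff_conj)
      have "real_of_rat q \<in> {g\<in>\<rat>. s - \<alpha> < g \<and> ereal g < packing_dim G}" using q by simp
      from bspec[OF elim this] show False using less by simp
    qed
    then show ?case using packing_dim_mono[of "covering_set \<xi> l \<omega> \<inter> G" G] by simp
  qed
  moreover have "AE \<omega> in M. covering_set \<xi> l \<omega> \<inter> G \<noteq> {}"
    using dim
  proof eventually_elim
    case (elim \<omega>)
    have "packing_dim (covering_set \<xi> l \<omega> \<inter> G) \<noteq> - \<infinity>" using elim G(2) by auto
    then show ?case by (auto simp: packing_dim_def)
  qed
  ultimately show "(AE \<omega> in M. covering_set \<xi> l \<omega> \<inter> G \<noteq> {}) \<and>
      (AE \<omega> in M. packing_dim (covering_set \<xi> l \<omega> \<inter> G) = packing_dim G)" by blast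
qed

end
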